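(* Let $\mathcal D$ be a triangulated category with a bounded $t$-structure $(\mathcal D^{\leq 0},\mathcal D^{\geq 0})$, let $d\geq 1$, and let $\mathcal T\subseteq\mathcal D^{[-d+1,0]}$ be $d$-FAE closed. Then $W''(\mathcal T)$ is a wide subcategory of $\mathcal D^{[-d+1,0]}$.
   Context: All subcategories are full, closed under isomorphisms and contain the zero object. $\mathcal D^{\leq n}=\mathcal D^{\leq 0}[-n]$, $\mathcal D^{\geq m}=\mathcal D^{\geq 0}[-m]$, $\mathcal D^{[m,n]}=\mathcal D^{\leq n}\cap\mathcal D^{\geq m}$. A subcategory $\mathcal X$ of $\mathcal D$ is closed under extensions if for each triangle $A\to Z\to B\to A[1]$ with $A,B\in\mathcal X$ one has $Z\in\mathcal X$. For $\mathcal X\subseteq\mathcal D^{[-d+1,0]}$, an object $Z\in\mathcal D^{[-d+1,0]}$ is a $d$-factor of $\mathcal X$ if there exist triangles $Z_i\to X_i\to Z_{i-1}\to Z_i[1]$, $1\leq i\leq d$, with $Z_0=Z$, $Z_1,\dots,Z_d\in\mathcal D^{[-d+1,0]}$ and $X_1,\dots,X_d\in\mathcal X$. $\mathcal X$ is $d$-FAE closed if it contains all its $d$-factors and is closed under extensions. For $\mathcal T$ $d$-FAE closed, $W'(\mathcal T)=\{X\in\mathcal T:\operatorname{Hom}(\mathcal T,X[-1])=0\}$. This is an exact category whose conflations are the sequences $X\to Y\to Z$ in $W'(\mathcal T)$ that complete to triangles $X\to Y\to Z\to X[1]$ in $\mathcal D$. A morphism in an exact category is admissible if it is a composite $gh$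 with $h$ a deflation and $g$ an inflation. $W''(\mathcal T)=\{X\in W'(\mathcal T):\text{every morphism in }W'(\mathcal T)\text{ with target }X\text{ is admissible in }W'(\mathcal T)\}$. A subcategory $\mathcal W\subseteq\mathcal D^{[-d+1,0]}$ is wide if (1) $\mathcal W$ is closed under extensions; (2) $\operatorname{Hom}(\mathcal W,\mathcal W[i])=0$ for all $i<0$; (3) $\mathcal W$ is an abelian category such that, for $X,Y,Z\in\mathcal W$, $0\to X\to Y\to Z\to 0$ is a short exact sequence if and only if $X\to Y\to Z$ completes to a triangle $X\to Y\to Z\to X[1]$ in $\mathcal D$. *)

theory Defs
  imports "HOL-Algebra.Group"
begin

section \<open>Additive and abelian categories\<close>

record ('o, 'm) cat =
  Obj :: "'o set"
  Arr :: "'m set"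
  Dom :: "'m \<Rightarrow> 'o"
  Cod :: "'m \<Rightarrow> 'o"
  Ident :: "'o \<Rightarrow> 'm"
  Comp :: "'m \<Rightarrow> 'm \<Rightarrow> 'm"  (infixr \<open>\<cdot>\<index>\<close> 75)

text \<open>\<open>g \<cdot> f\<close> is \<open>f\<close> followed by \<open>g\<close>.  All operations are only constrained on \<open>Obj\<close> and \<open>Arr\<close>.\<close>

definition Hom :: "('o, 'm, 'x) cat_scheme \<Rightarrow> 'o \<Rightarrow> 'o \<Rightarrow> 'm set" where
  "Hom C X Y = {f \<in> Arr C. Dom C f = X \<and> Cod C f = Y}"

locale category =
  fixes C :: "('o, 'm, 'x) cat_scheme" (structure)
  assumes dom_obj: "f \<in> Arr C \<Longrightarrow> Dom C f \<in> Obj C"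
    and cod_obj: "f \<in> Arr C \<Longrightarrow> Cod C f \<in> Obj C"
    and ident_hom: "X \<in> Obj C \<Longrightarrow> Ident C X \<in> Hom C X X"
    and comp_hom: "\<lbrakk>f \<in> Hom C X Y; g \<in> Hom C Y Z\<rbrakk> \<Longrightarrow> g \<cdot> f \<in> Hom C X Z"
    and comp_assoc:
      "\<lbrakk>f \<in> Hom C W X; g \<in> Hom C X Y; h \<in> Hom C Y Z\<rbrakk> \<Longrightarrow> h \<cdot> (g \<cdot> f) = (h \<cdot> g) \<cdot> f"
    and comp_ident_right: "f \<in> Hom C X Y \<Longrightarrow> f \<cdot> Ident C X = f"
    and comp_ident_left: "f \<in> Hom C X Y \<Longrightarrow> Ident C Y \<cdot> f = f"

definition is_iso :: "('o, 'm, 'x) cat_scheme \<Rightarrow> 'o \<Rightarrow> 'o \<Rightarrow> 'm \<Rightarrow> bool" where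
  "is_iso C X Y f \<longleftrightarrow> f \<in> Hom C X Y \<and>
     (\<exists>g \<in> Hom C Y X. g \<cdot>\<^bsub>C\<^esub> f = Ident C X \<and> f \<cdot>\<^bsub>C\<^esub> g = Ident C Y)"

definition isomorphic :: "('o, 'm, 'x) cat_scheme \<Rightarrow> 'o \<Rightarrow> 'o \<Rightarrow> bool" where
  "isomorphic C X Y \<longleftrightarrow> (\<exists>f. is_iso C X Y f)"

definition zero_object :: "('o, 'm, 'x) cat_scheme \<Rightarrow> 'o \<Rightarrow> bool" where
  "zero_object C Z \<longleftrightarrow> Z \<in> Obj C \<and>
     (\<forall>X \<in> Obj C. (\<exists>!f. f \<in> Hom C Z X) \<and> (\<exists>!f. f \<in> Hom C X Z))"

definition monic :: "('o, 'm, 'x) cat_scheme \<Rightarrow> 'm \<Rightarrow> bool" where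
  "monic C f \<longleftrightarrow> f \<in> Arr C \<and>
     (\<forall>W \<in> Obj C. \<forall>u \<in> Hom C W (Dom C f). \<forall>v \<in> Hom C W (Dom C f).
        f \<cdot>\<^bsub>C\<^esub> u = f \<cdot>\<^bsub>C\<^esub> v \<longrightarrow> u = v)"

definition epic :: "('o, 'm, 'x) cat_scheme \<Rightarrow> 'm \<Rightarrow> bool" where
  "epic C f \<longleftrightarrow> f \<in> Arr C \<and>
     (\<forall>W \<in> Obj C. \<forall>u \<in> Hom C (Cod C f) W. \<forall>v \<in> Hom C (Cod C f) W.
        u \<cdot>\<^bsub>C\<^esub> f = v \<cdot>\<^bsub>C\<^esub> f \<longrightarrow> u = v)"

record ('o, 'm) precat = "('o, 'm) cat" +
  Add :: "'m \<Rightarrow> 'm \<Rightarrow> 'm"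
  Zer :: "'o \<Rightarrow> 'o \<Rightarrow> 'm"

text \<open>The abelian group on a Hom-set, as a multiplicatively written group of HOL-Algebra.\<close>

definition hom_group :: "('o, 'm, 'x) precat_scheme \<Rightarrow> 'o \<Rightarrow> 'o \<Rightarrow> 'm monoid" where
  "hom_group C X Y = \<lparr>carrier = Hom C X Y, monoid.mult = Add C, one = Zer C X Y\<rparr>"

definition Neg :: "('o, 'm, 'x) precat_scheme \<Rightarrow> 'm \<Rightarrow> 'm" where
  "Neg C f = inv\<^bsub>hom_group C (Dom C f) (Cod C f)\<^esub> f"

locale preadditive_category = category C
  for C :: "('o, 'm, 'x) precat_scheme" (structure) +
  assumes hom_comm_group: "\<lbrakk>X \<in> Obj C; Y \<in> Obj C\<rbrakk> \<Longrightarrow> comm_group (hom_group C X Y)"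
    and comp_add_right: "\<lbrakk>f \<in> Hom C X Y; f' \<in> Hom C X Y; g \<in> Hom C Y Z\<rbrakk>
      \<Longrightarrow> g \<cdot> Add C f f' = Add C (g \<cdot> f) (g \<cdot> f')"
    and comp_add_left: "\<lbrakk>f \<in> Hom C X Y; g \<in> Hom C Y Z; g' \<in> Hom C Y Z\<rbrakk>
      \<Longrightarrow> Add C g g' \<cdot> f = Add C (g \<cdot> f) (g' \<cdot> f)"

definition biproduct ::
  "('o, 'm, 'x) precat_scheme \<Rightarrow> 'o \<Rightarrow> 'o \<Rightarrow> 'o \<Rightarrow> 'm \<Rightarrow> 'm \<Rightarrow> 'm \<Rightarrow> 'm \<Rightarrow> bool" where
  "biproduct C X Y B i j p q \<longleftrightarrow>
     B \<in> Obj C \<and> i \<in> Hom C X B \<and> j \<in> Hom C Y B \<and> p \<in> Hom C B X \<and> q \<in> Hom C B Y \<and>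
     p \<cdot>\<^bsub>C\<^esub> i = Ident C X \<and> q \<cdot>\<^bsub>C\<^esub> j = Ident C Y \<and>
     p \<cdot>\<^bsub>C\<^esub> j = Zer C Y X \<and> q \<cdot>\<^bsub>C\<^esub> i = Zer C X Y \<and>
     Add C (i \<cdot>\<^bsub>C\<^esub> p) (j \<cdot>\<^bsub>C\<^esub> q) = Ident C B"

locale additive_category = preadditive_category C
  for C :: "('o, 'm, 'x) precat_scheme" (structure) +
  assumes has_zero_object: "\<exists>Z. zero_object C Z"
    and has_biproducts: "\<lbrakk>X \<in> Obj C; Y \<in> Obj C\<rbrakk> \<Longrightarrow> \<exists>B i j p q. biproduct C X Y B i j p q"

definition is_kernel :: "('o, 'm, 'x) precat_scheme \<Rightarrow> 'm \<Rightarrow> 'm \<Rightarrow> bool" where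
  "is_kernel C k f \<longleftrightarrow> f \<in> Arr C \<and> k \<in> Arr C \<and> Cod C k = Dom C f \<and>
     f \<cdot>\<^bsub>C\<^esub> k = Zer C (Dom C k) (Cod C f) \<and>
     (\<forall>W \<in> Obj C. \<forall>u \<in> Hom C W (Dom C f). f \<cdot>\<^bsub>C\<^esub> u = Zer C W (Cod C f) \<longrightarrow>
        (\<exists>!v. v \<in> Hom C W (Dom C k) \<and> k \<cdot>\<^bsub>C\<^esub> v = u))"

definition is_cokernel :: "('o, 'm, 'x) precat_scheme \<Rightarrow> 'm \<Rightarrow> 'm \<Rightarrow> bool" where
  "is_cokernel C c f \<longleftrightarrow> f \<in> Arr C \<and> c \<in> Arr C \<and> Dom C c = Cod C f \<and>
     c \<cdot>\<^bsub>C\<^esub> f = Zer C (Dom C f) (Cod C c) \<and>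
     (\<forall>W \<in> Obj C. \<forall>u \<in> Hom C (Cod C f) W. u \<cdot>\<^bsub>C\<^esub> f = Zer C (Dom C f) W \<longrightarrow>
        (\<exists>!v. v \<in> Hom C (Cod C c) W \<and> v \<cdot>\<^bsub>C\<^esub> c = u))"

locale abelian_category = additive_category C
  for C :: "('o, 'm, 'x) precat_scheme" (structure) +
  assumes has_kernels: "f \<in> Arr C \<Longrightarrow> \<exists>k. is_kernel C k f"
    and has_cokernels: "f \<in> Arr C \<Longrightarrow> \<exists>c. is_cokernel C c f"
    and monic_normal: "monic C f \<Longrightarrow> \<exists>g. is_kernel C f g"
    and epic_normal: "epic C f \<Longrightarrow> \<exists>g. is_cokernel C f g"

definition is_image :: "('o, 'm, 'x) precat_scheme \<Rightarrow> 'm \<Rightarrow> 'm \<Rightarrow> bool" where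
  "is_image C i f \<longleftrightarrow> (\<exists>c. is_cokernel C c f \<and> is_kernel C i c)"

definition exact_at :: "('o, 'm, 'x) precat_scheme \<Rightarrow> 'm \<Rightarrow> 'm \<Rightarrow> bool" where
  "exact_at C f g \<longleftrightarrow> (\<exists>i. is_image C i f \<and> is_kernel C i g)"

definition short_exact ::
  "('o, 'm, 'x) precat_scheme \<Rightarrow> 'o \<Rightarrow> 'o \<Rightarrow> 'o \<Rightarrow> 'm \<Rightarrow> 'm \<Rightarrow> bool" where
  "short_exact C X Y Z f g \<longleftrightarrow> f \<in> Hom C X Y \<and> g \<in> Hom C Y Z \<and>
     (\<exists>N. zero_object C N \<and> exact_at C (Zer C N X) f \<and> exact_at C f g \<and>
        exact_at C g (Zer C Z N))"

definition full_sub :: "('o, 'm, 'x) precat_scheme \<Rightarrow> 'o set \<Rightarrow> ('o, 'm) precat" where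
  "full_sub C S = \<lparr>Obj = Obj C \<inter> S, Arr = {f \<in> Arr C. Dom C f \<in> S \<and> Cod C f \<in> S},
     Dom = Dom C, Cod = Cod C, Ident = Ident C, Comp = Comp C, Add = Add C, Zer = Zer C\<rparr>"

text \<open>Subcategories are full, closed under isomorphisms and contain the zero object, so
  they are given by their sets of objects.\<close>

definition subcategory :: "('o, 'm, 'x) cat_scheme \<Rightarrow> 'o set \<Rightarrow> bool" where
  "subcategory C S \<longleftrightarrow> S \<subseteq> Obj C \<and> (\<forall>X \<in> S. \<forall>Y \<in> Obj C. isomorphic C X Y \<longrightarrow> Y \<in> S) \<and>
     (\<forall>Z. zero_object C Z \<longrightarrow> Z \<in> S)"


section \<open>Triangulated categories\<close>

text \<open>\<open>ShO n\<close> and \<open>ShM n\<close> are the shift \<open>[n]\<close> on objects and on morphisms; \<open>Dist\<close> is the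
  class of distinguished triangles, each given by its three morphisms.\<close>

record ('o, 'm) tricat = "('o, 'm) precat" +
  ShO :: "int \<Rightarrow> 'o \<Rightarrow> 'o"
  ShM :: "int \<Rightarrow> 'm \<Rightarrow> 'm"
  Dist :: "('m \<times> 'm \<times> 'm) set"

definition candidate ::
  "('o, 'm, 'x) tricat_scheme \<Rightarrow> 'o \<Rightarrow> 'o \<Rightarrow> 'o \<Rightarrow> 'm \<Rightarrow> 'm \<Rightarrow> 'm \<Rightarrow> bool" where
  "candidate D X Y Z f g h \<longleftrightarrow> f \<in> Hom D X Y \<and> g \<in> Hom D Y Z \<and> h \<in> Hom D Z (ShO D 1 X)"

definition triangle ::
  "('o, 'm, 'x) tricat_scheme \<Rightarrow> 'o \<Rightarrow> 'o \<Rightarrow> 'o \<Rightarrow> 'm \<Rightarrow> 'm \<Rightarrow> 'm \<Rightarrow> bool" where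
  "triangle D X Y Z f g h \<longleftrightarrow> candidate D X Y Z f g h \<and> (f, g, h) \<in> Dist D"

definition triangle_on :: "('o, 'm, 'x) tricat_scheme \<Rightarrow> 'o \<Rightarrow> 'o \<Rightarrow> 'o \<Rightarrow> bool" where
  "triangle_on D X Y Z \<longleftrightarrow> (\<exists>f g h. triangle D X Y Z f g h)"

definition triangle_morphism ::
  "('o, 'm, 'x) tricat_scheme \<Rightarrow> 'm \<times> 'm \<times> 'm \<Rightarrow> 'm \<times> 'm \<times> 'm \<Rightarrow> 'm \<Rightarrow> 'm \<Rightarrow> 'm \<Rightarrow> bool"
where
  "triangle_morphism D = (\<lambda>(f, g, h) (f', g', h') a b c.
     b \<cdot>\<^bsub>D\<^esub> f = f' \<cdot>\<^bsub>D\<^esub> a \<and> c \<cdot>\<^bsub>D\<^esub> g = g' \<cdot>\<^bsub>D\<^esub> b \<and> ShM D 1 a \<cdot>\<^bsub>D\<^esub> h = h' \<cdot>\<^bsub>D\<^esub> c)"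

text \<open>The shift is an automorphism \<open>[1]\<close> of the additive category together with its
  integer powers; being strictly invertible it is encoded as an action of the integers.\<close>

locale triangulated_category = additive_category D
  for D :: "('o, 'm, 'x) tricat_scheme" (structure) +
  assumes shift_obj: "X \<in> Obj D \<Longrightarrow> ShO D n X \<in> Obj D"
    and shift_hom: "f \<in> Hom D X Y \<Longrightarrow> ShM D n f \<in> Hom D (ShO D n X) (ShO D n Y)"
    and shift_ident: "X \<in> Obj D \<Longrightarrow> ShM D n (Ident D X) = Ident D (ShO D n X)"
    and shift_comp:
      "\<lbrakk>f \<in> Hom D X Y; g \<in> Hom D Y Z\<rbrakk> \<Longrightarrow> ShM D n (g \<cdot> f) = ShM D n g \<cdot> ShM D n f"
    and shift_add:
      "\<lbrakk>f \<in> Hom D X Y; g \<in> Hom D X Y\<rbrakk> \<Longrightarrow> ShM D n (Add D f g) = Add D (ShM D n f) (ShM D n g)"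
    and shift_obj_0: "X \<in> Obj D \<Longrightarrow> ShO D 0 X = X"
    and shift_arr_0: "f \<in> Arr D \<Longrightarrow> ShM D 0 f = f"
    and shift_obj_plus: "X \<in> Obj D \<Longrightarrow> ShO D (m + n) X = ShO D m (ShO D n X)"
    and shift_arr_plus: "f \<in> Arr D \<Longrightarrow> ShM D (m + n) f = ShM D m (ShM D n f)"
    and dist_candidate: "(f, g, h) \<in> Dist D \<Longrightarrow> \<exists>X Y Z. candidate D X Y Z f g h"
    and TR1_ident: "\<lbrakk>X \<in> Obj D; zero_object D Z\<rbrakk>
      \<Longrightarrow> triangle D X X Z (Ident D X) (Zer D X Z) (Zer D Z (ShO D 1 X))"
    and TR1_iso: "\<lbrakk>triangle D X Y Z f g h; candidate D X' Y' Z' f' g' h';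
        is_iso D X X' a; is_iso D Y Y' b; is_iso D Z Z' c;
        triangle_morphism D (f, g, h) (f', g', h') a b c\<rbrakk>
      \<Longrightarrow> triangle D X' Y' Z' f' g' h'"
    and TR1_cone: "f \<in> Hom D X Y \<Longrightarrow> \<exists>Z g h. triangle D X Y Z f g h"
    and TR2: "candidate D X Y Z f g h
      \<Longrightarrow> triangle D X Y Z f g h \<longleftrightarrow> triangle D Y Z (ShO D 1 X) g h (Neg D (ShM D 1 f))"
    and TR3: "\<lbrakk>triangle D X Y Z f g h; triangle D X' Y' Z' f' g' h';
        a \<in> Hom D X X'; b \<in> Hom D Y Y'; b \<cdot> f = f' \<cdot> a\<rbrakk>
      \<Longrightarrow> \<exists>c \<in> Hom D Z Z'. triangle_morphism D (f, g, h) (f', g', h') a b c"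
    and TR4: "\<lbrakk>triangle D X Y U f f' f''; triangle D Y Z V g g' g'';
        triangle D X Z W (g \<cdot> f) h' h''\<rbrakk>
      \<Longrightarrow> \<exists>a b. triangle D U W V a b (ShM D 1 f' \<cdot> g'') \<and>
            triangle_morphism D (f, f', f'') (g \<cdot> f, h', h'') (Ident D X) g a \<and>
            triangle_morphism D (g \<cdot> f, h', h'') (g, g', g'') f (Ident D Z) b"

definition Hom_zero :: "('o, 'm, 'x) precat_scheme \<Rightarrow> 'o \<Rightarrow> 'o \<Rightarrow> bool" where
  "Hom_zero D X Y \<longleftrightarrow> Hom D X Y = {Zer D X Y}"

definition extension_closed :: "('o, 'm, 'x) tricat_scheme \<Rightarrow> 'o set \<Rightarrow> bool" where
  "extension_closed D S \<longleftrightarrow> (\<forall>A \<in> S. \<forall>B \<in> S. \<forall>Z. triangle_on D A Z B \<longrightarrow> Z \<in> S)"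


section \<open>t-structures\<close>

text \<open>A t-structure is given by the object sets \<open>L\<close> and \<open>G\<close> of its aisle \<open>D\<^sup>\<le>\<^sup>0\<close> and
  its coaisle \<open>D\<^sup>\<ge>\<^sup>0\<close>.\<close>

definition D_le :: "('o, 'm, 'x) tricat_scheme \<Rightarrow> 'o set \<Rightarrow> int \<Rightarrow> 'o set" where
  "D_le D L n = ShO D (- n) ` L"

definition D_ge :: "('o, 'm, 'x) tricat_scheme \<Rightarrow> 'o set \<Rightarrow> int \<Rightarrow> 'o set" where
  "D_ge D G m = ShO D (- m) ` G"

definition D_interval ::
  "('o, 'm, 'x) tricat_scheme \<Rightarrow> 'o set \<Rightarrow> 'o set \<Rightarrow> int \<Rightarrow> int \<Rightarrow> 'o set" where
  "D_interval D L G m n = D_le D L n \<inter> D_ge D G m"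

definition t_structure :: "('o, 'm, 'x) tricat_scheme \<Rightarrow> 'o set \<Rightarrow> 'o set \<Rightarrow> bool" where
  "t_structure D L G \<longleftrightarrow> subcategory D L \<and> subcategory D G \<and>
     (\<forall>X \<in> D_le D L 0. \<forall>Y \<in> D_ge D G 1. Hom_zero D X Y) \<and>
     D_le D L 0 \<subseteq> D_le D L 1 \<and> D_ge D G 1 \<subseteq> D_ge D G 0 \<and>
     (\<forall>X \<in> Obj D. \<exists>A \<in> D_le D L 0. \<exists>B \<in> D_ge D G 1. triangle_on D A X B)"

definition bounded_t_structure :: "('o, 'm, 'x) tricat_scheme \<Rightarrow> 'o set \<Rightarrow> 'o set \<Rightarrow> bool" where
  "bounded_t_structure D L G \<longleftrightarrow> t_structure D L G \<and> Obj D = (\<Union>m n. D_interval D L G m n)"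


section \<open>d-FAE closed and wide subcategories\<close>

definition d_factor ::
  "('o, 'm, 'x) tricat_scheme \<Rightarrow> 'o set \<Rightarrow> 'o set \<Rightarrow> nat \<Rightarrow> 'o set \<Rightarrow> 'o \<Rightarrow> bool" where
  "d_factor D L G d S Z \<longleftrightarrow> Z \<in> D_interval D L G (- int d + 1) 0 \<and>
     (\<exists>(Zs :: nat \<Rightarrow> 'o) (Xs :: nat \<Rightarrow> 'o). Zs 0 = Z \<and>
        (\<forall>i \<in> {1..d}. Zs i \<in> D_interval D L G (- int d + 1) 0 \<and> Xs i \<in> S \<and>
           triangle_on D (Zs i) (Xs i) (Zs (i - 1))))"

definition d_FAE_closed ::
  "('o, 'm, 'x) tricat_scheme \<Rightarrow> 'o set \<Rightarrow> 'o set \<Rightarrow> nat \<Rightarrow> 'o set \<Rightarrow> bool" where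
  "d_FAE_closed D L G d S \<longleftrightarrow>
     subcategory D S \<and> S \<subseteq> D_interval D L G (- int d + 1) 0 \<and>
     (\<forall>Z. d_factor D L G d S Z \<longrightarrow> Z \<in> S) \<and> extension_closed D S"

definition W' :: "('o, 'm, 'x) tricat_scheme \<Rightarrow> 'o set \<Rightarrow> 'o set" where
  "W' D T = {X \<in> T. \<forall>Y \<in> T. Hom_zero D Y (ShO D (- 1) X)}"

text \<open>The exact structure of an extension closed subcategory \<open>S\<close> (used for \<open>S = W' D T\<close>):
  conflations are the sequences in \<open>S\<close> that complete to a triangle.\<close>

definition conflation :: "('o, 'm, 'x) tricat_scheme \<Rightarrow> 'o set \<Rightarrow> 'm \<Rightarrow> 'm \<Rightarrow> bool" where
  "conflation D S f g \<longleftrightarrow>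
     (\<exists>X \<in> S. \<exists>Y \<in> S. \<exists>Z \<in> S. \<exists>h. triangle D X Y Z f g h)"

definition inflation :: "('o, 'm, 'x) tricat_scheme \<Rightarrow> 'o set \<Rightarrow> 'm \<Rightarrow> bool" where
  "inflation D S f \<longleftrightarrow> (\<exists>g. conflation D S f g)"

definition deflation :: "('o, 'm, 'x) tricat_scheme \<Rightarrow> 'o set \<Rightarrow> 'm \<Rightarrow> bool" where
  "deflation D S g \<longleftrightarrow> (\<exists>f. conflation D S f g)"

definition admissible :: "('o, 'm, 'x) tricat_scheme \<Rightarrow> 'o set \<Rightarrow> 'm \<Rightarrow> bool" where
  "admissible D S f \<longleftrightarrow>
     (\<exists>g h. deflation D S h \<and> inflation D S g \<and> Cod D h = Dom D g \<and> f = g \<cdot>\<^bsub>D\<^esub> h)"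

definition W'' :: "('o, 'm, 'x) tricat_scheme \<Rightarrow> 'o set \<Rightarrow> 'o set" where
  "W'' D T = {X \<in> W' D T. \<forall>A \<in> W' D T. \<forall>f \<in> Hom D A X. admissible D (W' D T) f}"

definition wide_subcategory ::
  "('o, 'm, 'x) tricat_scheme \<Rightarrow> 'o set \<Rightarrow> 'o set \<Rightarrow> nat \<Rightarrow> 'o set \<Rightarrow> bool" where
  "wide_subcategory D L G d W \<longleftrightarrow>
     subcategory D W \<and> W \<subseteq> D_interval D L G (- int d + 1) 0 \<and>
     extension_closed D W \<and>
     (\<forall>X \<in> W. \<forall>Y \<in> W. \<forall>i < 0. Hom_zero D X (ShO D i Y)) \<and>
     abelian_category (full_sub D W) \<and>
     (\<forall>X \<in> W. \<forall>Y \<in> W. \<forall>Z \<in> W. \<forall>f \<in> Hom D X Y. \<forall>g \<in> Hom D Y Z.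
        short_exact (full_sub D W) X Y Z f g \<longleftrightarrow> (\<exists>h. triangle D X Y Z f g h))"

end

theory Submission
  imports Defs
begin

text \<open>Write \<open>E = W' D T\<close> and \<open>M = W'' D T\<close>, and call an object an extension of \<open>Q\<close> by \<open>K\<close> if it is the
middle term of a triangle from \<open>K\<close> to \<open>Q\<close>.  Everything rests on one characterisation: a morphism
\<open>f : A \<rightarrow> X\<close> of \<open>E\<close> is admissible if and only if its cone is an extension of \<open>Q\<close> by \<open>K[1]\<close> with
\<open>K\<close> and \<open>Q\<close> in \<open>E\<close>; these are then the kernel and the cokernel of \<open>f\<close>
(\<open>cone_of_admissible\<close>, \<open>admissible_if_cone\<close>).  In this form admissibility is a property of the
cone alone, and the octahedral axiom says how cones change.

Stability of \<open>M\<close> follows.  If \<open>X'' \<in> E\<close> is the quotient of \<open>X \<in> M\<close> by an object of \<open>E\<close>,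
a morphism into \<open>X''\<close> has the same cone as its pullback along \<open>X \<rightarrow> X''\<close>, so it is admissible
(\<open>targets_quotient\<close>).  If \<open>X\<close> is an extension of \<open>X''\<close> by \<open>X'\<close>, both in \<open>M\<close>, the cone of a
morphism \<open>A \<rightarrow> X\<close> is assembled from the cones of two morphisms of \<open>E\<close>, one into \<open>X''\<close> and one
into \<open>X'\<close>, and regrouping the pieces gives the required shape (\<open>targets_extension\<close>).  A morphism into
an admissible subobject of \<open>X \<in> M\<close> has the same kernel and image as its composite into \<open>X\<close>
(\<open>targets_subobject\<close>).  Hence a morphism between objects of \<open>M\<close> has kernel, image and cokernel in
\<open>M\<close>, and since \<open>Hom(E, E[-1]) = 0\<close> makes triangles in \<open>E\<close> into kernel-cokernel pairs, \<open>M\<close> is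
abelian and its short exact sequences are its triangles.

Besides extension closure and \<open>Hom(E, E[-1]) = 0\<close>, this argument needs from \<open>E\<close> that it
contains the images, and these are objects which are at the same time the cone of a morphism of
\<open>E\<close> and the cocone of a morphism of \<open>E\<close>.  Such an object lies between the right degrees: as
a cone it has no cohomology in positive degrees, as a cocone none below \<open>-d+1\<close>.  So it is a
\<open>d\<close>-factor of \<open>T\<close> (\<open>cone_in_T\<close>).  The vanishing of \<open>Hom(T, E[-1])\<close> is part of the definition
of \<open>E\<close>, and \<open>Hom(T, E[-n]) = 0\<close> for larger \<open>n\<close> follows by induction: for \<open>Y \<in> T\<close> the truncation of
\<open>Y[1]\<close> to degrees at least \<open>-d+1\<close> is again a \<open>d\<close>-factor of \<open>T\<close>
(\<open>shifted_truncation_in_T\<close>, \<open>negative_Hom_zero\<close>).\<close>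

section \<open>Zero morphisms and cancellation in preadditive categories\<close>

context category
begin

lemma hom_dom_obj: "f \<in> Hom C X Y \<Longrightarrow> X \<in> Obj C"
  using dom_obj by (auto simp: Hom_def)

lemma hom_cod_obj: "f \<in> Hom C X Y \<Longrightarrow> Y \<in> Obj C"
  using cod_obj by (auto simp: Hom_def)

end

context preadditive_category
begin

lemma zero_hom: "\<lbrakk>X \<in> Obj C; Y \<in> Obj C\<rbrakk> \<Longrightarrow> Zer C X Y \<in> Hom C X Y"
  using comm_group.axioms(2)[OF hom_comm_group] monoid.one_closed[OF group.is_monoid]
  by (fastforce simp: hom_group_def)

lemma add_hom: "\<lbrakk>f \<in> Hom C X Y; g \<in> Hom C X Y\<rbrakk> \<Longrightarrow> Add C f g \<in> Hom C X Y"
  using monoid.m_closed[OF group.is_monoid[OF comm_group.axioms(2)[OF hom_comm_group[of X Y]]], of f g]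
    hom_dom_obj hom_cod_obj
  by (simp add: hom_group_def)

lemma add_zero_right:
  assumes "f \<in> Hom C X Y" shows "Add C f (Zer C X Y) = f"
  using monoid.r_one[OF group.is_monoid[OF comm_group.axioms(2)[OF hom_comm_group[of X Y]]], of f]
    hom_dom_obj[OF assms] hom_cod_obj[OF assms] assms
  by (simp add: hom_group_def)

lemma add_zero_left:
  assumes "f \<in> Hom C X Y" shows "Add C (Zer C X Y) f = f"
  using monoid.l_one[OF group.is_monoid[OF comm_group.axioms(2)[OF hom_comm_group[of X Y]]], of f]
    hom_dom_obj[OF assms] hom_cod_obj[OF assms] assms
  by (simp add: hom_group_def)

lemma neg_hom:
  assumes "f \<in> Hom C X Y" shows "Neg C f \<in> Hom C X Y"
  using group.inv_closed[OF comm_group.axioms(2)[OF hom_comm_group[of X Y]], of f]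
    hom_dom_obj[OF assms] hom_cod_obj[OF assms] assms
  by (simp add: hom_group_def Neg_def Hom_def)

lemma add_neg:
  assumes "f \<in> Hom C X Y" shows "Add C f (Neg C f) = Zer C X Y"
  using group.r_inv[OF comm_group.axioms(2)[OF hom_comm_group[of X Y]], of f]
    hom_dom_obj[OF assms] hom_cod_obj[OF assms] assms
  by (simp add: hom_group_def Neg_def Hom_def)

lemma neg_unique:
  assumes "f \<in> Hom C X Y" "g \<in> Hom C X Y" "Add C f g = Zer C X Y" shows "g = Neg C f"
proof -
  interpret H: comm_group "hom_group C X Y"
    using hom_comm_group hom_dom_obj[OF assms(1)] hom_cod_obj[OF assms(1)] by blast
  have "inv\<^bsub>hom_group C X Y\<^esub> f = g"
    using assms H.m_comm by (intro H.inv_equality) (auto simp: hom_group_def)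
  then show ?thesis using assms by (auto simp: Neg_def Hom_def)
qed

lemma neg_neg:
  assumes "f \<in> Hom C X Y" shows "Neg C (Neg C f) = f"
  using group.inv_inv[OF comm_group.axioms(2)[OF hom_comm_group[of X Y]], of f]
    hom_dom_obj[OF assms] hom_cod_obj[OF assms] assms neg_hom[OF assms]
  by (simp add: hom_group_def Neg_def Hom_def)

lemma eq_if_diff_zero:
  assumes "f \<in> Hom C X Y" "g \<in> Hom C X Y" "Add C f (Neg C g) = Zer C X Y" shows "f = g"
  using neg_unique[OF assms(1) neg_hom[OF assms(2)] assms(3)] neg_neg assms by metis

lemma idempotent_is_zero:
  assumes "f \<in> Hom C X Y" "Add C f f = f" shows "f = Zer C X Y"
proof -
  interpret H: comm_group "hom_group C X Y"
    using hom_comm_group hom_dom_obj[OF assms(1)] hom_cod_obj[OF assms(1)] by blast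
  show ?thesis using H.l_cancel_one[of f f] assms by (simp add: hom_group_def)
qed

lemma comp_zero_right:
  assumes "X \<in> Obj C" "g \<in> Hom C Y Z" shows "g \<cdot> Zer C X Y = Zer C X Z"
proof -
  have z: "Zer C X Y \<in> Hom C X Y" using assms zero_hom hom_dom_obj by blast
  show ?thesis
    using comp_add_right[OF z z assms(2)] add_zero_right[OF z] idempotent_is_zero[OF comp_hom[OF z assms(2)]]
    by simp
qed

lemma comp_zero_left:
  assumes "f \<in> Hom C X Y" "Z \<in> Obj C" shows "Zer C Y Z \<cdot> f = Zer C X Z"
proof -
  have z: "Zer C Y Z \<in> Hom C Y Z" using assms zero_hom hom_cod_obj by blast
  show ?thesis
    using comp_add_left[OF assms(1) z z] add_zero_right[OF z] idempotent_is_zero[OF comp_hom[OF assms(1) z]]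
    by simp
qed

lemma comp_neg_right:
  assumes "f \<in> Hom C X Y" "g \<in> Hom C Y Z" shows "g \<cdot> Neg C f = Neg C (g \<cdot> f)"
proof -
  have n: "Neg C f \<in> Hom C X Y" using assms neg_hom by blast
  have "Add C (g \<cdot> f) (g \<cdot> Neg C f) = Zer C X Z"
    using comp_add_right[OF assms(1) n assms(2)] add_neg[OF assms(1)] comp_zero_right assms hom_dom_obj
    by metis
  then show ?thesis using neg_unique comp_hom assms n by blast
qed

lemma comp_neg_left:
  assumes "f \<in> Hom C X Y" "g \<in> Hom C Y Z" shows "Neg C g \<cdot> f = Neg C (g \<cdot> f)"
proof -
  have n: "Neg C g \<in> Hom C Y Z" using assms neg_hom by blast
  have "Add C (g \<cdot> f) (Neg C g \<cdot> f) = Zer C X Z"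
    using comp_add_left[OF assms(1) assms(2) n] add_neg[OF assms(2)] comp_zero_left assms hom_cod_obj
    by metis
  then show ?thesis using neg_unique comp_hom assms n by blast
qed

lemma neg_zero: "\<lbrakk>X \<in> Obj C; Y \<in> Obj C\<rbrakk> \<Longrightarrow> Neg C (Zer C X Y) = Zer C X Y"
  using neg_unique add_zero_left zero_hom by metis

text \<open>Monomorphisms and epimorphisms are detected by the morphisms that they kill.\<close>

lemma cancel_left:
  assumes f: "f \<in> Hom C Y Z" and u: "u \<in> Hom C X Y" and v: "v \<in> Hom C X Y" and eq: "f \<cdot> u = f \<cdot> v"
    and kills: "\<And>w. \<lbrakk>w \<in> Hom C X Y; f \<cdot> w = Zer C X Z\<rbrakk> \<Longrightarrow> w = Zer C X Y"
  shows "u = v"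
proof -
  have d: "Add C u (Neg C v) \<in> Hom C X Y" using u v neg_hom add_hom by blast
  have "f \<cdot> Add C u (Neg C v) = Zer C X Z"
    using comp_add_right[OF u neg_hom[OF v] f] comp_neg_right[OF v f] eq add_neg[OF comp_hom[OF v f]] by simp
  then show ?thesis using eq_if_diff_zero[OF u v] kills[OF d] by blast
qed

lemma cancel_right:
  assumes f: "f \<in> Hom C X Y" and u: "u \<in> Hom C Y Z" and v: "v \<in> Hom C Y Z" and eq: "u \<cdot> f = v \<cdot> f"
    and kills: "\<And>w. \<lbrakk>w \<in> Hom C Y Z; w \<cdot> f = Zer C X Z\<rbrakk> \<Longrightarrow> w = Zer C Y Z"
  shows "u = v"
proof -
  have d: "Add C u (Neg C v) \<in> Hom C Y Z" using u v neg_hom add_hom by blast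
  have "Add C u (Neg C v) \<cdot> f = Zer C X Z"
    using comp_add_left[OF f u neg_hom[OF v]] comp_neg_left[OF f v] eq add_neg[OF comp_hom[OF f v]] by simp
  then show ?thesis using eq_if_diff_zero[OF u v] kills[OF d] by blast
qed

lemma unique_lift:
  assumes f: "f \<in> Hom C Y Z" and v: "v \<in> Hom C X Y" "f \<cdot> v = u"
    and kills: "\<And>w. \<lbrakk>w \<in> Hom C X Y; f \<cdot> w = Zer C X Z\<rbrakk> \<Longrightarrow> w = Zer C X Y"
  shows "\<exists>!v. v \<in> Hom C X Y \<and> f \<cdot> v = u"
proof (rule ex1I[of _ v])
  show "v \<in> Hom C X Y \<and> f \<cdot> v = u" using v by (rule conjI)
  fix w assume "w \<in> Hom C X Y \<and> f \<cdot> w = u"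
  then have w: "w \<in> Hom C X Y" "f \<cdot> w = f \<cdot> v" using v(2) by simp_all
  show "w = v" using kills by (rule cancel_left[OF f w(1) v(1) w(2)])
qed

lemma unique_descent:
  assumes f: "f \<in> Hom C X Y" and v: "v \<in> Hom C Y Z" "v \<cdot> f = u"
    and kills: "\<And>w. \<lbrakk>w \<in> Hom C Y Z; w \<cdot> f = Zer C X Z\<rbrakk> \<Longrightarrow> w = Zer C Y Z"
  shows "\<exists>!v. v \<in> Hom C Y Z \<and> v \<cdot> f = u"
proof (rule ex1I[of _ v])
  show "v \<in> Hom C Y Z \<and> v \<cdot> f = u" using v by (rule conjI)
  fix w assume "w \<in> Hom C Y Z \<and> w \<cdot> f = u"
  then have w: "w \<in> Hom C Y Z" "w \<cdot> f = v \<cdot> f" using v(2) by simp_all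
  show "w = v" using kills by (rule cancel_right[OF f w(1) v(1) w(2)])
qed

lemma zero_object_homs:
  assumes "zero_object C N"
  shows "f \<in> Hom C N X \<Longrightarrow> f = Zer C N X" "f \<in> Hom C X N \<Longrightarrow> f = Zer C X N"
proof -
  have N: "N \<in> Obj C" using assms by (simp add: zero_object_def)
  show "f = Zer C N X" if "f \<in> Hom C N X"
    using assms that zero_hom[OF N, of X] hom_cod_obj[OF that] unfolding zero_object_def by metis
  show "f = Zer C X N" if "f \<in> Hom C X N"
    using assms that zero_hom[OF _ N, of X] hom_dom_obj[OF that] unfolding zero_object_def by metis
qed

lemma zero_object_iff: "zero_object C N \<longleftrightarrow> N \<in> Obj C \<and> Ident C N = Zer C N N"
proof (intro iffI conjI)
  assume z: "zero_object C N"
  then show "N \<in> Obj C" by (simp add: zero_object_def)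
  then show "Ident C N = Zer C N N" using zero_object_homs[OF z] ident_hom by blast
next
  assume a: "N \<in> Obj C \<and> Ident C N = Zer C N N"
  have "f = Zer C N X" if "f \<in> Hom C N X" for f X
    using comp_ident_right[OF that] comp_zero_right[OF _ that, of N] a by simp
  moreover have "f = Zer C X N" if "f \<in> Hom C X N" for f X
    using comp_ident_left[OF that] comp_zero_left[OF that, of N] a by simp
  ultimately show "zero_object C N"
    unfolding zero_object_def using a zero_hom by metis
qed

end

section \<open>Triangles and exact sequences of morphisms\<close>

context triangulated_category
begin

lemma shift_shift: "X \<in> Obj D \<Longrightarrow> ShO D m (ShO D n X) = ShO D (m + n) X"
  by (simp add: shift_obj_plus)

lemma shift_shift_arr: "f \<in> Hom D X Y \<Longrightarrow> ShM D m (ShM D n f) = ShM D (m + n) f"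
  by (simp add: shift_arr_plus Hom_def)

lemma shift_zero_arr: "f \<in> Hom D X Y \<Longrightarrow> ShM D 0 f = f"
  by (simp add: shift_arr_0 Hom_def)

lemmas shift_simps = shift_shift shift_obj_0 shift_obj

lemma unshift_hom:
  assumes "f \<in> Hom D (ShO D n X) (ShO D n Y)" "X \<in> Obj D" "Y \<in> Obj D"
  shows "ShM D (- n) f \<in> Hom D X Y" "ShM D n (ShM D (- n) f) = f"
  using shift_hom[OF assms(1), of "- n"] assms shift_shift_arr[OF assms(1), of n "-n"] shift_zero_arr[OF assms(1)]
  by (simp_all add: shift_simps)

lemma shift_zero:
  assumes "X \<in> Obj D" "Y \<in> Obj D" shows "ShM D n (Zer D X Y) = Zer D (ShO D n X) (ShO D n Y)"
proof -
  have z: "Zer D X Y \<in> Hom D X Y" using assms zero_hom by blast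
  show ?thesis
    using shift_add[OF z z, of n] add_zero_right[OF z] idempotent_is_zero[OF shift_hom[OF z]] by simp
qed

lemma shift_neg:
  assumes "f \<in> Hom D X Y" shows "ShM D n (Neg D f) = Neg D (ShM D n f)"
  using neg_unique[OF shift_hom[OF assms] shift_hom[OF neg_hom[OF assms]], of n]
    shift_add[OF assms neg_hom[OF assms], of n] add_neg[OF assms] shift_zero hom_dom_obj hom_cod_obj assms
  by metis

lemma shift_zero_object: "zero_object D N \<Longrightarrow> zero_object D (ShO D n N)"
  unfolding zero_object_iff using shift_ident shift_zero shift_obj by metis

lemma Hom_zeroI:
  assumes "X \<in> Obj D" "Y \<in> Obj D" "\<And>f. f \<in> Hom D X Y \<Longrightarrow> f = Zer D X Y"
  shows "Hom_zero D X Y"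
  using assms zero_hom unfolding Hom_zero_def by blast

lemma Hom_zeroD: "\<lbrakk>Hom_zero D X Y; f \<in> Hom D X Y\<rbrakk> \<Longrightarrow> f = Zer D X Y"
  unfolding Hom_zero_def by blast

lemma Hom_zero_shift:
  assumes "X \<in> Obj D" "Y \<in> Obj D"
  shows "Hom_zero D (ShO D n X) (ShO D n Y) \<longleftrightarrow> Hom_zero D X Y"
proof
  assume h: "Hom_zero D X Y"
  show "Hom_zero D (ShO D n X) (ShO D n Y)"
    using unshift_hom[OF _ assms] Hom_zeroD[OF h] shift_zero assms shift_obj by (metis Hom_zeroI)
next
  assume h: "Hom_zero D (ShO D n X) (ShO D n Y)"
  show "Hom_zero D X Y"
  proof (rule Hom_zeroI[OF assms])
    fix f assume f: "f \<in> Hom D X Y"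
    have "ShM D n f = ShM D n (Zer D X Y)" using Hom_zeroD[OF h shift_hom[OF f]] shift_zero assms by simp
    then have "ShM D (- n) (ShM D n f) = ShM D (- n) (ShM D n (Zer D X Y))" by simp
    then show "f = Zer D X Y"
      using f zero_hom[OF assms] shift_zero_arr by (simp add: shift_shift_arr)
  qed
qed

lemma triangleD:
  assumes "triangle D X Y Z f g h"
  shows "f \<in> Hom D X Y" "g \<in> Hom D Y Z" "h \<in> Hom D Z (ShO D 1 X)"
    "X \<in> Obj D" "Y \<in> Obj D" "Z \<in> Obj D"
  using assms hom_dom_obj hom_cod_obj unfolding triangle_def candidate_def by blast+

lemma triangle_rotate:
  "triangle D X Y Z f g h \<Longrightarrow> triangle D Y Z (ShO D 1 X) g h (Neg D (ShM D 1 f))"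
  using TR2 unfolding triangle_def by blast

text \<open>The signs are kept explicit in the rotation rules because \<open>admissible_if_cone\<close> has to recover
the given morphism, and not only a morphism with an isomorphic cone.\<close>

lemma triangle_rotate_back:
  assumes t: "triangle D X Y Z f g h"
  shows "triangle D (ShO D (- 1) Z) X Y (Neg D (ShM D (- 1) h)) f g"
proof -
  note o = triangleD[OF t]
  have h': "ShM D (- 1) h \<in> Hom D (ShO D (- 1) Z) X"
    using shift_hom[OF o(3), of "- 1"] o by (simp add: shift_simps)
  have "Neg D (ShM D 1 (Neg D (ShM D (- 1) h))) = h"
    using shift_neg[OF h', of 1] neg_neg[OF shift_hom[OF h', of 1]] shift_shift_arr[OF o(3), of 1 "- 1"]
      shift_zero_arr[OF o(3)]
    by simp
  moreover have "candidate D (ShO D (- 1) Z) X Y (Neg D (ShM D (- 1) h)) f g"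
    using o neg_hom[OF h'] by (simp add: candidate_def shift_simps)
  ultimately show ?thesis
    using TR2 t o by (simp add: shift_simps)
qed

lemma triangle_negate:
  assumes t: "triangle D X Y Z f g h"
  shows "triangle D X Y Z (Neg D f) g (Neg D h)" "triangle D X Y Z (Neg D f) (Neg D g) h"
proof -
  note o = triangleD[OF t]
  have i: "is_iso D V V (Ident D V)" if "V \<in> Obj D" for V
    unfolding is_iso_def using that ident_hom comp_ident_left by blast
  have n: "is_iso D V V (Neg D (Ident D V))" if "V \<in> Obj D" for V
  proof -
    have v: "Ident D V \<in> Hom D V V" using that ident_hom by blast
    have "Neg D (Ident D V) \<cdot> Neg D (Ident D V) = Ident D V"
      using comp_neg_left[OF neg_hom[OF v] v] comp_ident_left[OF neg_hom[OF v]] neg_neg[OF v] by simp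
    then show ?thesis unfolding is_iso_def using neg_hom[OF v] by blast
  qed
  have idn: "Neg D (Ident D V) \<cdot> f = Neg D f" if "f \<in> Hom D U V" for U V f
    using that comp_neg_left[OF that ident_hom] comp_ident_left hom_cod_obj by metis
  have idn': "f \<cdot> Neg D (Ident D U) = Neg D f" if "f \<in> Hom D U V" for U V f
    using that comp_neg_right[OF ident_hom that] comp_ident_right hom_dom_obj by metis
  have s: "ShM D 1 (Neg D (Ident D X)) = Neg D (Ident D (ShO D 1 X))"
    using o shift_neg[OF ident_hom] shift_ident by metis
  have s': "ShM D 1 (Ident D X) = Ident D (ShO D 1 X)" using o shift_ident by blast
  note nf = neg_hom[OF o(1)] and ng = neg_hom[OF o(2)] and nh = neg_hom[OF o(3)]
  show "triangle D X Y Z (Neg D f) g (Neg D h)"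
    by (rule TR1_iso[OF t _ n[OF o(4)] i[OF o(5)] i[OF o(6)]])
      (simp_all add: candidate_def triangle_morphism_def s o nf nh idn'[OF nf] idn[OF o(3)] neg_neg[OF o(1)]
        comp_ident_left[OF o(1)] comp_ident_left[OF o(2)] comp_ident_right[OF o(2)] comp_ident_right[OF nh])
  show "triangle D X Y Z (Neg D f) (Neg D g) h"
    by (rule TR1_iso[OF t _ i[OF o(4)] n[OF o(5)] i[OF o(6)]])
      (simp_all add: candidate_def triangle_morphism_def s' o nf ng idn[OF o(1)] idn'[OF ng] neg_neg[OF o(2)]
        comp_ident_left[OF o(2)] comp_ident_left[OF o(3)] comp_ident_right[OF o(3)] comp_ident_right[OF nf])
qed

lemma triangle_shift_up:
  assumes t: "triangle D X Y Z f g h"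
  shows "triangle D (ShO D 1 X) (ShO D 1 Y) (ShO D 1 Z) (ShM D 1 f) (ShM D 1 g) (Neg D (ShM D 1 h))"
  using triangle_negate(2)[OF triangle_rotate[OF triangle_rotate[OF triangle_rotate[OF t]]]]
    neg_neg shift_hom triangleD[OF t]
  by metis

lemma triangle_shift_down:
  assumes t: "triangle D X Y Z f g h"
  shows "triangle D (ShO D (- 1) X) (ShO D (- 1) Y) (ShO D (- 1) Z)
    (ShM D (- 1) f) (ShM D (- 1) g) (Neg D (ShM D (- 1) h))"
  using triangle_negate(2)[OF triangle_rotate_back[OF triangle_rotate_back[OF triangle_rotate_back[OF t]]]]
    neg_neg shift_hom triangleD[OF t]
  by metis

lemma triangle_on_obj: "triangle_on D X Y Z \<Longrightarrow> X \<in> Obj D \<and> Y \<in> Obj D \<and> Z \<in> Obj D"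
  unfolding triangle_on_def using triangleD(4-6) by blast

lemma triangle_on_rotate: "triangle_on D X Y Z \<Longrightarrow> triangle_on D Y Z (ShO D 1 X)"
  unfolding triangle_on_def using triangle_rotate by blast

lemma triangle_on_rotate_back: "triangle_on D X Y Z \<Longrightarrow> triangle_on D (ShO D (- 1) Z) X Y"
  unfolding triangle_on_def using triangle_rotate_back by blast

lemma triangle_on_shift:
  assumes "triangle_on D X Y Z"
  shows "triangle_on D (ShO D n X) (ShO D n Y) (ShO D n Z)"
proof (induction n rule: int_induct[where k = 0])
  case base
  then show ?case using assms triangle_on_obj[OF assms] by (simp add: shift_obj_0)
next
  case (step1 n)
  then show ?case
    using triangle_on_rotate[OF triangle_on_rotate[OF triangle_on_rotate[OF step1(2)]]]
      triangle_on_obj[OF assms] by (simp add: shift_shift add.commute)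
next
  case (step2 n)
  then show ?case
    using triangle_on_rotate_back[OF triangle_on_rotate_back[OF triangle_on_rotate_back[OF step2(2)]]]
      triangle_on_obj[OF assms] by (simp add: shift_shift)
qed

lemma triangle_comp_zero:
  assumes t: "triangle D X Y Z f g h" shows "g \<cdot> f = Zer D X Z"
proof -
  note o = triangleD[OF t]
  obtain N where N: "zero_object D N" using has_zero_object by blast
  obtain c where c: "c \<in> Hom D N Z" and m: "triangle_morphism D
      (Ident D X, Zer D X N, Zer D N (ShO D 1 X)) (f, g, h) (Ident D X) f c"
    using TR3[OF TR1_ident[OF o(4) N] t ident_hom[OF o(4)] o(1)] by blast
  have "g \<cdot> f = c \<cdot> Zer D X N" using m by (simp add: triangle_morphism_def)
  then show ?thesis using comp_zero_right[OF o(4) c] by simp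
qed

text \<open>Exactness of \<open>Hom W\<close> at the middle term.  A morphism into \<open>Y\<close> that dies in \<open>Z\<close> is a morphism to
the rotated triangle from the rotation of the trivial triangle on \<open>W\<close>; the third component
provided by \<open>TR3\<close>, shifted back, is the lift.\<close>

lemma triangle_lift:
  assumes t: "triangle D X Y Z f g h" and u: "u \<in> Hom D W Y" and gu: "g \<cdot> u = Zer D W Z"
  obtains v where "v \<in> Hom D W X" "f \<cdot> v = u"
proof -
  note o = triangleD[OF t]
  have W: "W \<in> Obj D" using u hom_dom_obj by blast
  obtain N where N: "zero_object D N" using has_zero_object by blast
  then have N': "N \<in> Obj D" by (simp add: zero_object_def)
  have z: "Zer D N Z \<in> Hom D N Z" using zero_hom N' o by blast
  have "Zer D N Z \<cdot> Zer D W N = g \<cdot> u"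
    using gu comp_zero_right[OF W z] by simp
  then obtain c where c: "c \<in> Hom D (ShO D 1 W) (ShO D 1 X)" and m: "triangle_morphism D
      (Zer D W N, Zer D N (ShO D 1 W), Neg D (ShM D 1 (Ident D W))) (g, h, Neg D (ShM D 1 f)) u (Zer D N Z) c"
    using TR3[OF triangle_rotate[OF TR1_ident[OF W N]] triangle_rotate[OF t] u z] by blast
  note su = shift_hom[OF u, of 1] and sf = shift_hom[OF o(1), of 1]
  have e: "ShM D 1 u \<cdot> Neg D (Ident D (ShO D 1 W)) = Neg D (ShM D 1 f) \<cdot> c"
    using m shift_ident[OF W, of 1] by (simp add: triangle_morphism_def)
  have "ShM D 1 u \<cdot> Neg D (Ident D (ShO D 1 W)) = Neg D (ShM D 1 u)"
    using comp_neg_right[OF ident_hom su] comp_ident_right[OF su] W shift_obj by simp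
  then have "Neg D (ShM D 1 u) = Neg D (ShM D 1 f \<cdot> c)"
    using e comp_neg_left[OF c sf] by simp
  then have eq: "ShM D 1 u = ShM D 1 f \<cdot> c"
    using neg_neg su comp_hom[OF c sf] by metis
  have v: "ShM D (- 1) c \<in> Hom D W X" using unshift_hom[OF c W o(4)] by blast
  have "u = ShM D (- 1) (ShM D 1 u)" using shift_shift_arr[OF u] shift_zero_arr[OF u] by simp
  also have "\<dots> = ShM D (- 1) (ShM D 1 f) \<cdot> ShM D (- 1) c" using eq shift_comp[OF c sf] by simp
  also have "ShM D (- 1) (ShM D 1 f) = f" using shift_shift_arr[OF o(1)] shift_zero_arr[OF o(1)] by simp
  finally show ?thesis using that[OF v] by simp
qed

text \<open>Dually, a morphism out of \<open>Y\<close> that kills \<open>X\<close> maps the triangle to the one whose second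
morphism is the identity of \<open>W\<close>.\<close>

lemma triangle_descend:
  assumes t: "triangle D X Y Z f g h" and u: "u \<in> Hom D Y W" and uf: "u \<cdot> f = Zer D X W"
  obtains v where "v \<in> Hom D Z W" "v \<cdot> g = u"
proof -
  note o = triangleD[OF t]
  have W: "W \<in> Obj D" using u hom_cod_obj by blast
  obtain N where N: "zero_object D N" using has_zero_object by blast
  let ?N = "ShO D (- 1) N" and ?n = "Neg D (ShM D (- 1) (Zer D N (ShO D 1 W)))"
  note t' = triangle_rotate_back[OF TR1_ident[OF W N]]
  have z: "Zer D X ?N \<in> Hom D X ?N" using zero_hom o triangleD[OF t'] by blast
  have "u \<cdot> f = ?n \<cdot> Zer D X ?N" using uf comp_zero_right[OF o(4) triangleD(1)[OF t']] by simp
  then obtain c where c: "c \<in> Hom D Z W" and m: "triangle_morphism D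
      (f, g, h) (?n, Ident D W, Zer D W N) (Zer D X ?N) u c"
    using TR3[OF t t' z u] by blast
  then have "c \<cdot> g = u" using comp_ident_left[OF u] by (simp add: triangle_morphism_def)
  then show ?thesis using that c by blast
qed

lemma octahedron:
  assumes "triangle D X Y U f f' f''" "triangle D Y Z V g g' g''" "triangle D X Z W (g \<cdot> f) h' h''"
  shows "triangle_on D U W V"
  using TR4[OF assms] unfolding triangle_on_def by blast

text \<open>Associativity of the operation on classes of objects that sends a pair of classes to the
  class of all extensions.\<close>

lemma extension_reassociate:
  assumes "triangle_on D K N U" "triangle_on D N F V"
  obtains Q where "triangle_on D K F Q" "triangle_on D U Q V"
proof -
  obtain f f' f'' g g' g'' where t: "triangle D K N U f f' f''" "triangle D N F V g g' g''"
    using assms unfolding triangle_on_def by blast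
  obtain Q h' h'' where q: "triangle D K F Q (g \<cdot> f) h' h''"
    using TR1_cone[OF comp_hom[OF triangleD(1)[OF t(1)] triangleD(1)[OF t(2)]]] by blast
  show ?thesis using that octahedron[OF t q] q unfolding triangle_on_def by blast
qed

lemma iso_triangle:
  assumes "is_iso D X Y f" "zero_object D N"
  obtains h where "triangle D X Y N f (Zer D Y N) h"
proof -
  have f: "f \<in> Hom D X Y" using assms unfolding is_iso_def by blast
  have o: "X \<in> Obj D" "Y \<in> Obj D" "N \<in> Obj D"
    using f assms hom_dom_obj hom_cod_obj unfolding zero_object_def by blast+
  have i: "is_iso D V V (Ident D V)" if "V \<in> Obj D" for V
    unfolding is_iso_def using that ident_hom comp_ident_left by blast
  have zX: "Zer D X N \<in> Hom D X N" and zY: "Zer D Y N \<in> Hom D Y N"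
    and zN: "Zer D N (ShO D 1 X) \<in> Hom D N (ShO D 1 X)"
    using o shift_obj zero_hom by blast+
  have "triangle D X Y N f (Zer D Y N) (Zer D N (ShO D 1 X))"
    by (rule TR1_iso[OF TR1_ident[OF o(1) assms(2)] _ i[OF o(1)] assms(1) i[OF o(3)]])
      (simp_all add: candidate_def triangle_morphism_def f zY zN comp_ident_left[OF zX] comp_ident_right[OF f]
        shift_ident[OF o(1)] comp_ident_left[OF zN] comp_ident_right[OF zN] comp_zero_left[OF f o(3)])
  then show ?thesis using that by blast
qed

text \<open>A vanishing cone gives a right inverse by lifting the identity, and the same exact sequence
one step to the left shows that the morphism is a monomorphism.\<close>

lemma iso_if_cone_zero:
  assumes t: "triangle D X Y N f g h" and N: "zero_object D N"
  shows "is_iso D X Y f"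
proof -
  note o = triangleD[OF t]
  have iX: "Ident D X \<in> Hom D X X" and iY: "Ident D Y \<in> Hom D Y Y" using o ident_hom by auto
  have "g \<cdot> Ident D Y = Zer D Y N" using zero_object_homs(2)[OF N comp_hom[OF iY o(2)]] .
  then obtain r where r: "r \<in> Hom D Y X" "f \<cdot> r = Ident D Y" using triangle_lift[OF t iY] by blast
  have inj: "w = Zer D X X" if w: "w \<in> Hom D X X" "f \<cdot> w = Zer D X Y" for w
  proof -
    note t' = triangle_rotate_back[OF t]
    obtain v where "v \<in> Hom D X (ShO D (- 1) N)" "Neg D (ShM D (- 1) h) \<cdot> v = w"
      using triangle_lift[OF t' w] by blast
    then show ?thesis
      using zero_object_homs(2)[OF shift_zero_object[OF N]] comp_zero_right[OF o(4) triangleD(1)[OF t']]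
      by metis
  qed
  have "f \<cdot> (r \<cdot> f) = f \<cdot> Ident D X"
    using comp_assoc[OF o(1) r(1) o(1)] r(2) comp_ident_left[OF o(1)] comp_ident_right[OF o(1)] by simp
  then have "r \<cdot> f = Ident D X" using cancel_left[OF o(1) comp_hom[OF o(1) r(1)] iX] inj by blast
  then show ?thesis using r o unfolding is_iso_def by blast
qed

text \<open>An isomorphism is a triangle with zero third term, so closure under isomorphisms is an instance
of closure under extensions.\<close>

lemma subcategory_if_extension_closed:
  assumes "S \<subseteq> Obj D" "extension_closed D S" and zero: "\<And>N. zero_object D N \<Longrightarrow> N \<in> S"
  shows "subcategory D S"
  unfolding subcategory_def
proof (intro conjI ballI allI impI)
  show "S \<subseteq> Obj D" by (rule assms(1))
  show "N \<in> S" if "zero_object D N" for N by (rule zero[OF that])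
  fix X Y assume X: "X \<in> S" and iso: "isomorphic D X Y"
  obtain N where N: "zero_object D N" using has_zero_object by blast
  obtain f where f: "is_iso D X Y f" using iso unfolding isomorphic_def by blast
  then obtain h where "triangle D X Y N f (Zer D Y N) h" using iso_triangle[OF _ N] by blast
  then show "Y \<in> S"
    using assms(2) X zero[OF N] unfolding extension_closed_def triangle_on_def by blast
qed

end

section \<open>Admissible morphisms and their cones\<close>

definition admissible_targets :: "('o, 'm, 'x) tricat_scheme \<Rightarrow> 'o set \<Rightarrow> 'o set" where
  "admissible_targets D E = {X \<in> E. \<forall>A \<in> E. \<forall>f \<in> Hom D A X. admissible D E f}"

text \<open>What the construction uses of \<open>W' D T\<close>.  The vanishing of \<open>Hom(E, E[-1])\<close> makes a triangle in
\<open>E\<close> a kernel-cokernel pair.  The last assumption puts images into \<open>E\<close>: if \<open>A \<rightarrow> X\<close> has kernel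
\<open>K\<close> and cokernel \<open>Z\<close>, its image is the cone of \<open>K \<rightarrow> A\<close> and the cocone of \<open>X \<rightarrow> Z\<close>.\<close>

locale negative_free_exact = triangulated_category D
  for D :: "('o, 'm, 'x) tricat_scheme" (structure) +
  fixes E :: "'o set"
  assumes subcat: "subcategory D E"
    and ext_closed: "extension_closed D E"
    and neg_hom_zero: "\<lbrakk>X \<in> E; Y \<in> E\<rbrakk> \<Longrightarrow> Hom_zero D X (ShO D (- 1) Y)"
    and cone_and_cocone: "\<lbrakk>triangle_on D V U Q; triangle_on D Q X Z; V \<in> E; U \<in> E; X \<in> E; Z \<in> E\<rbrakk>
      \<Longrightarrow> Q \<in> E"
begin

abbreviation "M \<equiv> admissible_targets D E"

lemma in_obj: "X \<in> E \<Longrightarrow> X \<in> Obj D"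
  using subcat unfolding subcategory_def by blast

lemma extension_in: "\<lbrakk>triangle_on D X Y Z; X \<in> E; Z \<in> E\<rbrakk> \<Longrightarrow> Y \<in> E"
  using ext_closed unfolding extension_closed_def by blast

lemma targets_in_E: "X \<in> M \<Longrightarrow> X \<in> E"
  by (simp add: admissible_targets_def)

lemma targets_admissible: "\<lbrakk>X \<in> M; A \<in> E; f \<in> Hom D A X\<rbrakk> \<Longrightarrow> admissible D E f"
  by (simp add: admissible_targets_def)

lemma targetsI: "\<lbrakk>X \<in> E; \<And>A f. \<lbrakk>A \<in> E; f \<in> Hom D A X\<rbrakk> \<Longrightarrow> admissible D E f\<rbrakk> \<Longrightarrow> X \<in> M"
  by (simp add: admissible_targets_def)

text \<open>The kernel of composition with \<open>f\<close> consists of morphisms that factor through \<open>Z[-1]\<close>; dually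
for \<open>g\<close> and \<open>X[1]\<close>.\<close>

lemma conflation_mono:
  assumes t: "triangle D X Y Z f g h" and "W \<in> E" "Z \<in> E"
    and u: "u \<in> Hom D W X" "f \<cdot> u = Zer D W Y"
  shows "u = Zer D W X"
proof -
  note t' = triangle_rotate_back[OF t]
  obtain v where "v \<in> Hom D W (ShO D (- 1) Z)" "Neg D (ShM D (- 1) h) \<cdot> v = u"
    using triangle_lift[OF t' u] by blast
  then show ?thesis
    using Hom_zeroD[OF neg_hom_zero[OF assms(2,3)]] comp_zero_right[OF in_obj[OF assms(2)] triangleD(1)[OF t']]
    by metis
qed

lemma conflation_epi:
  assumes t: "triangle D X Y Z f g h" and "W \<in> E" "X \<in> E"
    and u: "u \<in> Hom D Z W" "u \<cdot> g = Zer D Y W"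
  shows "u = Zer D Z W"
proof -
  have "Hom_zero D (ShO D 1 X) W"
    using neg_hom_zero[OF assms(3,2)] Hom_zero_shift[of X "ShO D (- 1) W" 1] in_obj assms(2,3)
    by (simp add: shift_simps)
  moreover obtain v where "v \<in> Hom D (ShO D 1 X) W" "v \<cdot> h = u"
    using triangle_descend[OF triangle_rotate[OF t] u] by blast
  ultimately show ?thesis
    using Hom_zeroD comp_zero_left[OF triangleD(3)[OF t] in_obj[OF assms(2)]] by metis
qed

lemma admissible_factor:
  assumes "admissible D E f" and f: "f \<in> Hom D A X"
  obtains K I Q k h p g r c where "K \<in> E" "I \<in> E" "Q \<in> E"
    "triangle D K A I k h p" "triangle D I X Q g r c" "f = g \<cdot> h"
proof -
  obtain g h where gh: "deflation D E h" "inflation D E g" "Cod D h = Dom D g" "f = g \<cdot> h"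
    using assms unfolding admissible_def by blast
  obtain K A' I k p where 1: "K \<in> E" "I \<in> E" "triangle D K A' I k h p"
    using gh(1) unfolding deflation_def conflation_def by blast
  obtain I' X' Q r c where 2: "Q \<in> E" "triangle D I' X' Q g r c"
    using gh(2) unfolding inflation_def conflation_def by blast
  have I: "I' = I" using gh(3) triangleD(2)[OF 1(3)] triangleD(1)[OF 2(2)] by (simp add: Hom_def)
  have "f \<in> Hom D A' X'"
    using comp_hom triangleD(2)[OF 1(3)] triangleD(1)[OF 2(2)] I gh(4) by blast
  then have "A' = A" "X' = X" using f by (simp_all add: Hom_def)
  then show ?thesis using that 1 2 I gh(4) by blast
qed

lemma admissibleI:
  assumes "triangle D K A I k h p" "triangle D I X Q g r c" "K \<in> E" "A \<in> E" "I \<in> E" "X \<in> E" "Q \<in> E"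
  shows "admissible D E (g \<cdot> h)"
proof -
  have "Cod D h = Dom D g" using triangleD(2)[OF assms(1)] triangleD(1)[OF assms(2)] by (simp add: Hom_def)
  then show ?thesis
    using assms unfolding admissible_def deflation_def inflation_def conflation_def by blast
qed

text \<open>The octahedron on the composable pair \<open>A \<rightarrow> I \<rightarrow> X\<close>, whose cones are \<open>K[1]\<close> and \<open>Q\<close>.\<close>

lemma cone_of_admissible:
  assumes "admissible D E f" and t: "triangle D A X F f p q"
  obtains K Q where "K \<in> E" "Q \<in> E" "triangle_on D (ShO D 1 K) F Q"
proof -
  obtain K I Q k h p' g r c where *: "K \<in> E" "I \<in> E" "Q \<in> E"
    "triangle D K A I k h p'" "triangle D I X Q g r c" "f = g \<cdot> h"
    using admissible_factor[OF assms(1) triangleD(1)[OF t]] by blast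
  show ?thesis
    using that[OF *(1,3)] octahedron[OF triangle_rotate[OF *(4)] *(5)] t *(6) by blast
qed

text \<open>The octahedron on \<open>X \<rightarrow> F \<rightarrow> Q\<close> recovers the factorisation: the cocone \<open>I\<close> of the composite
is an extension of \<open>K[1]\<close> by \<open>A\<close>, which makes it the cone of a morphism \<open>K \<rightarrow> A\<close>, and
one of the commuting faces says that \<open>A \<rightarrow> I \<rightarrow> X\<close> is \<open>f\<close>.\<close>

lemma admissible_if_cone:
  assumes t: "triangle D A X F f p q" and F: "triangle_on D (ShO D 1 K) F Q"
    and E: "A \<in> E" "X \<in> E" "K \<in> E" "Q \<in> E"
  shows "admissible D E f"
proof -
  obtain e r s where er: "triangle D (ShO D 1 K) F Q e r s" using F unfolding triangle_on_def by blast
  note o = triangleD[OF t]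
  note t1 = triangle_rotate[OF t] and t2 = triangle_rotate[OF er]
  obtain V h' h'' where t3: "triangle D X Q V (r \<cdot> p) h' h''"
    using TR1_cone[OF comp_hom[OF triangleD(1)[OF t1] triangleD(1)[OF t2]]] by blast
  obtain a b where ab: "triangle D (ShO D 1 A) V (ShO D 1 (ShO D 1 K)) a b (ShM D 1 q \<cdot> Neg D (ShM D 1 e))"
    and m: "triangle_morphism D (p, q, Neg D (ShM D 1 f)) (r \<cdot> p, h', h'') (Ident D X) r a"
    using TR4[OF t1 t2 t3] by blast
  have sf: "ShM D 1 f \<in> Hom D (ShO D 1 A) (ShO D 1 X)" using shift_hom o by blast
  \<comment> \<open>This face of the octahedron carries the sign from rotating the triangle on \<open>f\<close>.\<close>
  have "Neg D (ShM D 1 f) = h'' \<cdot> a"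
    using m shift_ident[OF o(5)] comp_ident_left[OF neg_hom[OF sf]] by (simp add: triangle_morphism_def)
  then have "ShM D (- 1) (Neg D (ShM D 1 f)) = ShM D (- 1) h'' \<cdot> ShM D (- 1) a"
    using shift_comp[OF triangleD(1)[OF ab] triangleD(3)[OF t3]] by simp
  moreover have "ShM D (- 1) (Neg D (ShM D 1 f)) = Neg D f"
    using shift_neg[OF sf] shift_shift_arr[OF o(1)] shift_zero_arr[OF o(1)] by simp
  ultimately have "Neg D (ShM D (- 1) h'' \<cdot> ShM D (- 1) a) = f" using neg_neg[OF o(1)] by simp
  then have f: "Neg D (ShM D (- 1) h'') \<cdot> ShM D (- 1) a = f"
    using comp_neg_left[OF shift_hom[OF triangleD(1)[OF ab], of "- 1"]
        shift_hom[OF triangleD(3)[OF t3], of "- 1"]] by simp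
  let ?I = "ShO D (- 1) V"
  have kernel: "\<exists>k l. triangle D K A ?I k (ShM D (- 1) a) l"
    using triangle_rotate_back[OF triangle_shift_down[OF ab]] o in_obj[OF E(3)]
    by (auto simp: shift_simps)
  have cokernel: "triangle D ?I X Q (Neg D (ShM D (- 1) h'')) (r \<cdot> p) h'"
    using triangle_rotate_back[OF t3] .
  have "?I \<in> E"
    using cone_and_cocone[of K A ?I X Q] kernel cokernel E unfolding triangle_on_def by blast
  then show ?thesis using kernel admissibleI[OF _ cokernel] E f by metis
qed

text \<open>The pullback \<open>P\<close> of \<open>f : A \<rightarrow> X''\<close> along \<open>q\<close> is the cocone of \<open>X \<rightarrow> X'' \<rightarrow> cone f\<close>.  It is an
extension of \<open>A\<close> by \<open>X'\<close>, hence in \<open>E\<close>, and \<open>P \<rightarrow> X\<close> has by construction the same cone as \<open>f\<close>.\<close>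

lemma targets_quotient:
  assumes t: "triangle D X' X X'' i q h" and "X' \<in> E" "X \<in> M" "X'' \<in> E"
  shows "X'' \<in> M"
proof (rule targetsI[OF assms(4)])
  fix A f assume A: "A \<in> E" and f: "f \<in> Hom D A X''"
  obtain F p r where F: "triangle D A X'' F f p r" using TR1_cone[OF f] by blast
  obtain V s s' where V: "triangle D X F V (p \<cdot> q) s s'"
    using TR1_cone[OF comp_hom[OF triangleD(2)[OF t] triangleD(2)[OF F]]] by blast
  let ?P = "ShO D (- 1) V"
  have "triangle_on D (ShO D 1 X') V (ShO D 1 A)"
    using octahedron[OF triangle_rotate[OF t] triangle_rotate[OF F] V] .
  then have "triangle_on D X' ?P A"
    using triangle_on_shift[of "ShO D 1 X'" V "ShO D 1 A" "- 1"] assms A in_obj by (simp add: shift_simps)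
  then have P: "?P \<in> E" using extension_in assms A by blast
  note t' = triangle_rotate_back[OF V]
  obtain K Q where "K \<in> E" "Q \<in> E" "triangle_on D (ShO D 1 K) F Q"
    using cone_of_admissible[OF targets_admissible[OF assms(3) P triangleD(1)[OF t']] t'] by blast
  then show "admissible D E f" using admissible_if_cone[OF F] A assms(4) by blast
qed

text \<open>If \<open>i f = g h\<close> is the factorisation of the composite through its image \<open>I\<close>, then \<open>h\<close> also
divides \<open>f\<close>, as \<open>i\<close> is a monomorphism, and \<open>I\<close> embeds into \<open>X'\<close>.  The cone of that embedding is
also the cocone of \<open>cone g \<rightarrow> X''\<close>, which puts it into \<open>E\<close>.\<close>

lemma targets_subobject:
  assumes t: "triangle D X' X X'' i q s" and "X' \<in> E" "X \<in> M" "X'' \<in> E"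
  shows "X' \<in> M"
proof (rule targetsI[OF assms(2)])
  fix A f assume A: "A \<in> E" and f: "f \<in> Hom D A X'"
  note i = triangleD(1)[OF t]
  obtain K I Q k h p g r c where *: "K \<in> E" "I \<in> E" "Q \<in> E"
    "triangle D K A I k h p" "triangle D I X Q g r c" "i \<cdot> f = g \<cdot> h"
    using admissible_factor[OF targets_admissible[OF assms(3) A comp_hom[OF f i]] comp_hom[OF f i]] by blast
  note k = triangleD(1)[OF *(4)] and h = triangleD(2)[OF *(4)] and g = triangleD(1)[OF *(5)]
  have "i \<cdot> (f \<cdot> k) = g \<cdot> (h \<cdot> k)" using comp_assoc[OF k f i] comp_assoc[OF k h g] *(6) by simp
  also have "\<dots> = Zer D K X" using triangle_comp_zero[OF *(4)] comp_zero_right[OF in_obj[OF *(1)] g] by simp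
  finally have "f \<cdot> k = Zer D K X'"
    using conflation_mono[OF t *(1) assms(4) comp_hom[OF k f]] by blast
  then obtain j where j: "j \<in> Hom D I X'" "j \<cdot> h = f" using triangle_descend[OF *(4) f] by blast
  have ij: "i \<cdot> j = g"
  proof (rule cancel_right[OF h comp_hom[OF j(1) i] g])
    show "(i \<cdot> j) \<cdot> h = g \<cdot> h" using comp_assoc[OF h j(1) i] j(2) *(6) by simp
    show "w = Zer D I X" if "w \<in> Hom D I X" "w \<cdot> h = Zer D A X" for w
      using conflation_epi[OF *(4) targets_in_E[OF assms(3)] *(1) that] .
  qed
  obtain R r' c' where R: "triangle D I X' R j r' c'" using TR1_cone[OF j(1)] by blast
  have "triangle_on D R Q X''" using octahedron[OF R t] *(5) ij by blast
  then have "R \<in> E"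
    using cone_and_cocone[of I X' R Q X''] R * assms unfolding triangle_on_def by blast
  then show "admissible D E f" using admissibleI[OF *(4) R] * A assms j(2) by blast
qed

text \<open>Let \<open>F\<close> and \<open>G\<close> be the cones of \<open>f\<close> and \<open>q f\<close>.  By assumption \<open>G\<close> is an extension of \<open>C''\<close> by
\<open>K'[1]\<close>.  The morphism \<open>G \<rightarrow> X'[1]\<close> with cocone \<open>F\<close> restricts to the shift of some \<open>k : K' \<rightarrow> X'\<close>,
and then \<open>F\<close> is an extension of \<open>C''\<close> by the cone \<open>N\<close> of \<open>k\<close>.  Since \<open>X'\<close> is an admissible
target, \<open>N\<close> is an extension of \<open>C'\<close> by \<open>K[1]\<close>.  Regrouping, \<open>F\<close> is an extension of \<open>Q\<close>
by \<open>K[1]\<close>, where \<open>Q\<close> is an extension of \<open>C''\<close> by \<open>C'\<close>.\<close>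

lemma targets_extension:
  assumes t: "triangle D X' X X'' i q s" and "X' \<in> M" "X'' \<in> M"
  shows "X \<in> M"
proof (rule targetsI)
  note E' = targets_in_E[OF assms(2)] and E'' = targets_in_E[OF assms(3)]
  show X: "X \<in> E" using extension_in t E' E'' unfolding triangle_on_def by blast
  fix A f assume A: "A \<in> E" and f: "f \<in> Hom D A X"
  note q = triangleD(2)[OF t]
  obtain F p r where F: "triangle D A X F f p r" using TR1_cone[OF f] by blast
  obtain G p' r' where G: "triangle D A X'' G (q \<cdot> f) p' r'" using TR1_cone[OF comp_hom[OF f q]] by blast
  obtain K' C'' where K': "K' \<in> E" "C'' \<in> E" and "triangle_on D (ShO D 1 K') G C''"
    using cone_of_admissible[OF targets_admissible[OF assms(3) A comp_hom[OF f q]] G] by blast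
  then obtain m m' m'' where m: "triangle D (ShO D 1 K') G C'' m m' m''" unfolding triangle_on_def by blast
  obtain a b c where "triangle D F G (ShO D 1 X') a b c"
    using octahedron[OF F triangle_rotate[OF t] G] unfolding triangle_on_def by blast
  note b = triangle_rotate[OF this]
  have bm: "b \<cdot> m \<in> Hom D (ShO D 1 K') (ShO D 1 X')"
    using comp_hom triangleD(1)[OF m] triangleD(1)[OF b] by blast
  define k where "k = ShM D (- 1) (b \<cdot> m)"
  have k: "k \<in> Hom D K' X'" "ShM D 1 k = b \<cdot> m"
    using unshift_hom[OF bm in_obj[OF K'(1)] in_obj[OF E']] by (simp_all add: k_def)
  obtain N n n' where N: "triangle D K' X' N k n n'" using TR1_cone[OF k(1)] by blast
  obtain K C' where K: "K \<in> E" "C' \<in> E" "triangle_on D (ShO D 1 K) N C'"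
    using cone_of_admissible[OF targets_admissible[OF assms(2) K'(1) k(1)] N] by blast
  have N1: "triangle D (ShO D 1 K') (ShO D 1 X') (ShO D 1 N) (b \<cdot> m) (ShM D 1 n) (Neg D (ShM D 1 n'))"
    using triangle_shift_up[OF N] k(2) by simp
  have "triangle_on D C'' (ShO D 1 N) (ShO D 1 F)" using octahedron[OF m b N1] .
  then have "triangle_on D N F C''"
    using triangle_on_shift[OF triangle_on_rotate, of C'' "ShO D 1 N" "ShO D 1 F" "- 1"]
      triangleD(6)[OF N] triangleD(6)[OF F] in_obj[OF K'(2)]
    by (simp add: shift_simps)
  then obtain Q where Q: "triangle_on D (ShO D 1 K) F Q" "triangle_on D C' Q C''"
    using extension_reassociate[OF K(3)] by blast
  have "Q \<in> E" using extension_in[OF Q(2)] K K' by blast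
  then show "admissible D E f" using admissible_if_cone[OF F Q(1) A X K(1)] by blast
qed

lemma zero_in_E: "zero_object D N \<Longrightarrow> N \<in> E"
  using subcat unfolding subcategory_def by blast

lemma targets_zero:
  assumes N: "zero_object D N" shows "N \<in> M"
proof (rule targetsI[OF zero_in_E[OF N]])
  fix A f assume A: "A \<in> E" and f: "f \<in> Hom D A N"
  have N': "N \<in> Obj D" using N by (simp add: zero_object_def)
  have "admissible D E (Ident D N \<cdot> Zer D A N)"
    using admissibleI[OF TR1_ident[OF in_obj[OF A] N] TR1_ident[OF N' N]] A zero_in_E[OF N] by blast
  then show "admissible D E f"
    using comp_ident_left[OF f] zero_object_homs(2)[OF N f] by simp
qed

lemma targets_extension_closed: "extension_closed D M"
  unfolding extension_closed_def triangle_on_def using targets_extension by blast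

lemma targets_subcategory: "subcategory D M"
  using subcategory_if_extension_closed[OF _ targets_extension_closed] targets_in_E in_obj targets_zero by blast

text \<open>Kernel, image and cokernel stay in \<open>M\<close>: the image is a subobject of \<open>X\<close>, the cokernel a quotient of
\<open>X\<close>, and the kernel a subobject of \<open>A\<close>.\<close>

lemma targets_factor:
  assumes "A \<in> M" "X \<in> M" "f \<in> Hom D A X"
  obtains K I Q k h p g r c where "K \<in> M" "I \<in> M" "Q \<in> M"
    "triangle D K A I k h p" "triangle D I X Q g r c" "f = g \<cdot> h"
proof -
  obtain K I Q k h p g r c where *: "K \<in> E" "I \<in> E" "Q \<in> E"
    "triangle D K A I k h p" "triangle D I X Q g r c" "f = g \<cdot> h"
    using admissible_factor[OF targets_admissible[OF assms(2) targets_in_E[OF assms(1)] assms(3)] assms(3)] by blast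
  have "I \<in> M" "Q \<in> M" "K \<in> M"
    using targets_subobject[OF *(5)] targets_quotient[OF *(5)] targets_subobject[OF *(4)] * assms by blast+
  then show ?thesis using that * by blast
qed

end

section \<open>Full subcategories\<close>

context triangulated_category
begin

text \<open>The biproduct is built as the extension with zero connecting morphism rather than taken from
\<open>has_biproducts\<close>, since only then is it visibly in every subcategory closed under extensions.
The zero connecting morphism splits the triangle: the identity of \<open>Y\<close> lifts to \<open>j\<close>, and
\<open>1 - j q\<close> factors through \<open>i\<close>.\<close>

lemma biproduct_extension:
  assumes "X \<in> Obj D" "Y \<in> Obj D"
  obtains B i j p q where "biproduct D X Y B i j p q" "triangle_on D X B Y"
proof -
  have z: "Zer D (ShO D (- 1) Y) X \<in> Hom D (ShO D (- 1) Y) X" using assms zero_hom shift_obj by blast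
  obtain B i q' where t: "triangle D (ShO D (- 1) Y) X B (Zer D (ShO D (- 1) Y) X) i q'"
    using TR1_cone[OF z] by blast
  obtain q c where q: "triangle D X B Y i q c" and c: "c = Zer D Y (ShO D 1 X)"
    using triangle_rotate[OF t] assms
    by (force simp: shift_zero shift_simps neg_zero)
  note o = triangleD[OF q]
  note idX = ident_hom[OF assms(1)] and idY = ident_hom[OF assms(2)] and idB = ident_hom[OF o(5)]
  have "c \<cdot> Ident D Y = Zer D Y (ShO D 1 X)" using comp_ident_right[OF o(3)] c by simp
  then obtain j where j: "j \<in> Hom D Y B" "q \<cdot> j = Ident D Y" using triangle_lift[OF triangle_rotate[OF q] idY] by blast
  note jq = comp_hom[OF o(2) j(1)]
  have i_mono: "w = Zer D W X" if w: "w \<in> Hom D W X" "i \<cdot> w = Zer D W B" for w W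
  proof -
    obtain v where "v \<in> Hom D W (ShO D (- 1) Y)" "Zer D (ShO D (- 1) Y) X \<cdot> v = w"
      using triangle_lift[OF t w] by blast
    then show ?thesis using comp_zero_left[OF _ assms(1)] by metis
  qed
  let ?e = "Add D (Ident D B) (Neg D (j \<cdot> q))"
  have e: "?e \<in> Hom D B B" using idB jq neg_hom add_hom by blast
  have qjq: "q \<cdot> (j \<cdot> q) = q"
    using comp_assoc[OF o(2) j(1) o(2)] j(2) comp_ident_left[OF o(2)] by simp
  have "q \<cdot> ?e = Zer D B Y"
    using comp_add_right[OF idB neg_hom[OF jq] o(2)] comp_neg_right[OF jq o(2)] qjq
      comp_ident_right[OF o(2)] add_neg[OF o(2)] by simp
  then obtain p where p: "p \<in> Hom D B X" "i \<cdot> p = ?e" using triangle_lift[OF q e] by blast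
  have qi: "q \<cdot> i = Zer D X Y" using triangle_comp_zero[OF q] .
  have "i \<cdot> (p \<cdot> i) = ?e \<cdot> i" using comp_assoc[OF o(1) p(1) o(1)] p(2) by simp
  also have "\<dots> = Add D i (Neg D ((j \<cdot> q) \<cdot> i))"
    using comp_add_left[OF o(1) idB neg_hom[OF jq]] comp_ident_left[OF o(1)] comp_neg_left[OF o(1) jq] by simp
  also have "(j \<cdot> q) \<cdot> i = Zer D X B"
    using comp_assoc[OF o(1,2) j(1)] qi comp_zero_right[OF assms(1) j(1)] by simp
  also have "Add D i (Neg D (Zer D X B)) = i" using neg_zero[OF o(4,5)] add_zero_right[OF o(1)] by simp
  finally have pi: "p \<cdot> i = Ident D X"
    using cancel_left[OF o(1) comp_hom[OF o(1) p(1)] idX] i_mono comp_ident_right[OF o(1)] by simp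
  have "i \<cdot> (p \<cdot> j) = ?e \<cdot> j" using comp_assoc[OF j(1) p(1) o(1)] p(2) by simp
  also have "\<dots> = Add D j (Neg D ((j \<cdot> q) \<cdot> j))"
    using comp_add_left[OF j(1) idB neg_hom[OF jq]] comp_ident_left[OF j(1)] comp_neg_left[OF j(1) jq] by simp
  also have "(j \<cdot> q) \<cdot> j = j"
    using comp_assoc[OF j(1) o(2) j(1)] j(2) comp_ident_right[OF j(1)] by simp
  finally have pj: "p \<cdot> j = Zer D Y X" using i_mono[OF comp_hom[OF j(1) p(1)]] add_neg[OF j(1)] by simp
  interpret H: comm_group "hom_group D B B" using hom_comm_group o by blast
  have "Add D (Add D (Ident D B) (Neg D (j \<cdot> q))) (j \<cdot> q) = Ident D B"
    using H.m_assoc[of "Ident D B" "Neg D (j \<cdot> q)" "j \<cdot> q"] H.m_comm[of "Neg D (j \<cdot> q)" "j \<cdot> q"]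
      idB jq neg_hom[OF jq] add_neg[OF jq] add_zero_right[OF idB]
    by (simp add: hom_group_def)
  then have "biproduct D X Y B i j p q"
    unfolding biproduct_def using o j p pi pj qi by simp
  then show ?thesis using that q unfolding triangle_on_def by blast
qed

lemma full_sub_Hom:
  "S \<subseteq> Obj D \<Longrightarrow> f \<in> Hom (full_sub D S) X Y \<longleftrightarrow> f \<in> Hom D X Y \<and> X \<in> S \<and> Y \<in> S"
  by (auto simp: Hom_def full_sub_def)

lemma full_sub_simps [simp]:
  "Dom (full_sub D S) = Dom D" "Cod (full_sub D S) = Cod D" "Ident (full_sub D S) = Ident D"
  "Comp (full_sub D S) = Comp D" "Add (full_sub D S) = Add D" "Zer (full_sub D S) = Zer D"
  by (simp_all add: full_sub_def)

lemma full_sub_Obj: "S \<subseteq> Obj D \<Longrightarrow> Obj (full_sub D S) = S"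
  by (auto simp: full_sub_def)

lemma full_sub_Arr: "f \<in> Arr (full_sub D S) \<longleftrightarrow> f \<in> Arr D \<and> Dom D f \<in> S \<and> Cod D f \<in> S"
  by (simp add: full_sub_def)

lemma full_sub_hom_group:
  assumes "S \<subseteq> Obj D" "X \<in> S" "Y \<in> S" shows "hom_group (full_sub D S) X Y = hom_group D X Y"
proof -
  have "Hom (full_sub D S) X Y = Hom D X Y" using full_sub_Hom[OF assms(1)] assms by blast
  then show ?thesis by (simp add: hom_group_def)
qed

lemma full_sub_preadditive:
  assumes S: "S \<subseteq> Obj D" shows "preadditive_category (full_sub D S)"
proof (intro preadditive_category.intro category.intro preadditive_category_axioms.intro)
  show "Dom (full_sub D S) f \<in> Obj (full_sub D S)" "Cod (full_sub D S) f \<in> Obj (full_sub D S)"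
    if "f \<in> Arr (full_sub D S)" for f
    using that S by (auto simp: full_sub_Obj full_sub_Arr)
  show "comm_group (hom_group (full_sub D S) X Y)"
    if "X \<in> Obj (full_sub D S)" "Y \<in> Obj (full_sub D S)" for X Y
    using that full_sub_hom_group[OF S] hom_comm_group subsetD[OF S] by (simp add: full_sub_Obj[OF S])
qed (use S in \<open>auto simp: full_sub_Hom full_sub_Obj ident_hom comp_add_right comp_add_left
  comp_ident_left comp_ident_right intro: comp_hom comp_assoc\<close>)

lemma full_sub_zero_object:
  assumes S: "S \<subseteq> Obj D"
  shows "zero_object (full_sub D S) N \<longleftrightarrow> N \<in> S \<and> zero_object D N"
proof -
  interpret F: preadditive_category "full_sub D S" by (rule full_sub_preadditive[OF S])
  show ?thesis using F.zero_object_iff zero_object_iff full_sub_Obj[OF S] S by auto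
qed

lemma full_sub_additive:
  assumes "subcategory D S" "extension_closed D S" shows "additive_category (full_sub D S)"
proof -
  have S: "S \<subseteq> Obj D" using assms unfolding subcategory_def by blast
  interpret F: preadditive_category "full_sub D S" by (rule full_sub_preadditive[OF S])
  show ?thesis
  proof
    show "\<exists>Z. zero_object (full_sub D S) Z"
      using has_zero_object assms full_sub_zero_object[OF S] unfolding subcategory_def by blast
    fix X Y assume "X \<in> Obj (full_sub D S)" "Y \<in> Obj (full_sub D S)"
    then have XY: "X \<in> S" "Y \<in> S" using full_sub_Obj[OF S] by auto
    then obtain B i j p q where B: "biproduct D X Y B i j p q" "triangle_on D X B Y"
      using biproduct_extension S by blast
    then have "B \<in> S" using assms XY unfolding extension_closed_def by blast
    then have "biproduct (full_sub D S) X Y B i j p q"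
      using B(1) XY unfolding biproduct_def by (simp add: full_sub_Hom[OF S] full_sub_Obj[OF S])
    then show "\<exists>B i j p q. biproduct (full_sub D S) X Y B i j p q" by blast
  qed
qed

lemma is_kernel_full_sub:
  assumes S: "S \<subseteq> Obj D" and k: "k \<in> Hom D K A" and f: "f \<in> Hom D A X" and KAX: "K \<in> S" "A \<in> S" "X \<in> S"
  shows "is_kernel (full_sub D S) k f \<longleftrightarrow> f \<cdot> k = Zer D K X \<and>
    (\<forall>W \<in> S. \<forall>u \<in> Hom D W A. f \<cdot> u = Zer D W X \<longrightarrow> (\<exists>!v. v \<in> Hom D W K \<and> k \<cdot> v = u))"
proof -
  have e: "Dom D k = K" "Cod D k = A" "Dom D f = A" "Cod D f = X" "k \<in> Arr D" "f \<in> Arr D"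
    using k f by (simp_all add: Hom_def)
  show ?thesis
    unfolding is_kernel_def
    using KAX by (simp add: Ball_def e full_sub_Arr full_sub_Obj[OF S] full_sub_Hom[OF S] cong: conj_cong)
qed

lemma is_cokernel_full_sub:
  assumes S: "S \<subseteq> Obj D" and c: "c \<in> Hom D X Q" and f: "f \<in> Hom D A X" and KAX: "Q \<in> S" "A \<in> S" "X \<in> S"
  shows "is_cokernel (full_sub D S) c f \<longleftrightarrow> c \<cdot> f = Zer D A Q \<and>
    (\<forall>W \<in> S. \<forall>u \<in> Hom D X W. u \<cdot> f = Zer D A W \<longrightarrow> (\<exists>!v. v \<in> Hom D Q W \<and> v \<cdot> c = u))"
proof -
  have e: "Dom D c = X" "Cod D c = Q" "Dom D f = A" "Cod D f = X" "c \<in> Arr D" "f \<in> Arr D"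
    using c f by (simp_all add: Hom_def)
  show ?thesis
    unfolding is_cokernel_def
    using KAX by (simp add: Ball_def e full_sub_Arr full_sub_Obj[OF S] full_sub_Hom[OF S] cong: conj_cong)
qed

lemma monic_full_sub:
  assumes "S \<subseteq> Obj D" "monic (full_sub D S) f" "f \<in> Hom D A X"
    and "W \<in> S" "A \<in> S" "u \<in> Hom D W A" "v \<in> Hom D W A" "f \<cdot> u = f \<cdot> v"
  shows "u = v"
proof -
  have "Dom D f = A" using assms(3) by (simp add: Hom_def)
  then show ?thesis
    using assms(2,4-) unfolding monic_def by (simp add: full_sub_Obj[OF assms(1)] full_sub_Hom[OF assms(1)])
qed

lemma epic_full_sub:
  assumes "S \<subseteq> Obj D" "epic (full_sub D S) f" "f \<in> Hom D A X"
    and "W \<in> S" "X \<in> S" "u \<in> Hom D X W" "v \<in> Hom D X W" "u \<cdot> f = v \<cdot> f"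
  shows "u = v"
proof -
  have "Cod D f = X" using assms(3) by (simp add: Hom_def)
  then show ?thesis
    using assms(2,4-) unfolding epic_def by (simp add: full_sub_Obj[OF assms(1)] full_sub_Hom[OF assms(1)])
qed

lemma is_kernel_full_sub_arr:
  assumes "is_kernel (full_sub D S) k f" "f \<in> Hom D A X"
  obtains K where "k \<in> Hom D K A" "K \<in> S"
  using assms by (auto simp: is_kernel_def full_sub_Arr Hom_def)

lemma is_cokernel_full_sub_arr:
  assumes "is_cokernel (full_sub D S) c f" "f \<in> Hom D A X"
  obtains Q where "c \<in> Hom D X Q" "Q \<in> S"
  using assms by (auto simp: is_cokernel_def full_sub_Arr Hom_def)

end

section \<open>The abelian category of admissible targets\<close>

context negative_free_exact
begin

lemma targets_obj: "M \<subseteq> Obj D"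
  using targets_in_E in_obj by blast

lemma conflation_kernel:
  assumes t: "triangle D X Y Z f g h" and M: "X \<in> M" "Y \<in> M" "Z \<in> M"
  shows "is_kernel (full_sub D M) f g"
  unfolding is_kernel_full_sub[OF targets_obj triangleD(1,2)[OF t] M]
proof (intro conjI ballI impI)
  show "g \<cdot> f = Zer D X Z" by (rule triangle_comp_zero[OF t])
  fix W u assume W: "W \<in> M" and u: "u \<in> Hom D W Y" "g \<cdot> u = Zer D W Z"
  obtain v where v: "v \<in> Hom D W X" "f \<cdot> v = u" using triangle_lift[OF t u] .
  show "\<exists>!v. v \<in> Hom D W X \<and> f \<cdot> v = u"
    by (rule unique_lift[OF triangleD(1)[OF t] v conflation_mono[OF t targets_in_E[OF W] targets_in_E[OF M(3)]]])
qed

lemma conflation_cokernel: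
  assumes t: "triangle D X Y Z f g h" and M: "X \<in> M" "Y \<in> M" "Z \<in> M"
  shows "is_cokernel (full_sub D M) g f"
  unfolding is_cokernel_full_sub[OF targets_obj triangleD(2,1)[OF t] M(3,1,2)]
proof (intro conjI ballI impI)
  show "g \<cdot> f = Zer D X Z" by (rule triangle_comp_zero[OF t])
  fix W u assume W: "W \<in> M" and u: "u \<in> Hom D Y W" "u \<cdot> f = Zer D X W"
  obtain v where v: "v \<in> Hom D Z W" "v \<cdot> g = u" using triangle_descend[OF t u] .
  show "\<exists>!v. v \<in> Hom D Z W \<and> v \<cdot> g = u"
    by (rule unique_descent[OF triangleD(2)[OF t] v conflation_epi[OF t targets_in_E[OF W] targets_in_E[OF M(1)]]])
qed

lemma targets_kernel:
  assumes AX: "A \<in> M" "X \<in> M" and f: "f \<in> Hom D A X"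
  shows "\<exists>k. is_kernel (full_sub D M) k f"
proof -
  obtain K I Q k h p g r c where *: "K \<in> M" "I \<in> M" "Q \<in> M"
    "triangle D K A I k h p" "triangle D I X Q g r c" "f = g \<cdot> h"
    using targets_factor[OF assms] .
  note k = triangleD(1)[OF *(4)] and h = triangleD(2)[OF *(4)] and g = triangleD(1)[OF *(5)]
  \<comment> \<open>\<open>f\<close> and \<open>h\<close> kill the same morphisms from \<open>M\<close>, so they have the same kernels.\<close>
  have hu: "h \<cdot> u = Zer D W I \<longleftrightarrow> f \<cdot> u = Zer D W X" if "W \<in> M" "u \<in> Hom D W A" for W u
  proof
    have eq: "f \<cdot> u = g \<cdot> (h \<cdot> u)" using comp_assoc[OF that(2) h g] *(6) by simp
    show "f \<cdot> u = Zer D W X" if "h \<cdot> u = Zer D W I"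
      using eq that comp_zero_right[OF in_obj[OF targets_in_E[OF \<open>W \<in> M\<close>]] g] by simp
    show "h \<cdot> u = Zer D W I" if "f \<cdot> u = Zer D W X"
      using conflation_mono[OF *(5) targets_in_E[OF \<open>W \<in> M\<close>] targets_in_E[OF *(3)] comp_hom[OF \<open>u \<in> Hom D W A\<close> h]]
        eq that by simp
  qed
  have "is_kernel (full_sub D M) k h" using conflation_kernel[OF *(4,1) AX(1) *(2)] .
  then have "is_kernel (full_sub D M) k f"
    unfolding is_kernel_full_sub[OF targets_obj k h *(1) AX(1) *(2)] is_kernel_full_sub[OF targets_obj k f *(1) AX]
    using hu k *(1) by simp
  then show ?thesis ..
qed

lemma targets_cokernel:
  assumes AX: "A \<in> M" "X \<in> M" and f: "f \<in> Hom D A X"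
  shows "\<exists>c. is_cokernel (full_sub D M) c f"
proof -
  obtain K I Q k h p g r c where *: "K \<in> M" "I \<in> M" "Q \<in> M"
    "triangle D K A I k h p" "triangle D I X Q g r c" "f = g \<cdot> h"
    using targets_factor[OF assms] .
  note h = triangleD(2)[OF *(4)] and g = triangleD(1)[OF *(5)] and r = triangleD(2)[OF *(5)]
  \<comment> \<open>Likewise \<open>f\<close> and \<open>g\<close> have the same cokernels.\<close>
  have uh: "u \<cdot> g = Zer D I W \<longleftrightarrow> u \<cdot> f = Zer D A W" if "W \<in> M" "u \<in> Hom D X W" for W u
  proof
    have eq: "u \<cdot> f = (u \<cdot> g) \<cdot> h" using comp_assoc[OF h g that(2)] *(6) by simp
    show "u \<cdot> f = Zer D A W" if "u \<cdot> g = Zer D I W"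
      using eq that comp_zero_left[OF h in_obj[OF targets_in_E[OF \<open>W \<in> M\<close>]]] by simp
    show "u \<cdot> g = Zer D I W" if "u \<cdot> f = Zer D A W"
      using conflation_epi[OF *(4) targets_in_E[OF \<open>W \<in> M\<close>] targets_in_E[OF *(1)] comp_hom[OF g \<open>u \<in> Hom D X W\<close>]]
        eq that by simp
  qed
  have "is_cokernel (full_sub D M) r g" using conflation_cokernel[OF *(5,2) AX(2) *(3)] .
  then have "is_cokernel (full_sub D M) r f"
    unfolding is_cokernel_full_sub[OF targets_obj r g *(3,2) AX(2)] is_cokernel_full_sub[OF targets_obj r f *(3) AX]
    using uh r *(3) by simp
  then show ?thesis ..
qed

text \<open>The kernel of \<open>f\<close> is both zero and the cocone of \<open>A \<rightarrow> I\<close>, so \<open>A \<rightarrow> I\<close> is an isomorphism and the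
triangle on \<open>I \<rightarrow> X\<close> can be transported to \<open>A\<close>.\<close>

lemma mono_triangle:
  assumes AX: "A \<in> M" "X \<in> M" and f: "f \<in> Hom D A X"
    and mono: "\<And>W u. \<lbrakk>W \<in> M; u \<in> Hom D W A; f \<cdot> u = Zer D W X\<rbrakk> \<Longrightarrow> u = Zer D W A"
  obtains Q r c where "Q \<in> M" "triangle D A X Q f r c"
proof -
  obtain K I Q k h p g r c where *: "K \<in> M" "I \<in> M" "Q \<in> M"
    "triangle D K A I k h p" "triangle D I X Q g r c" "f = g \<cdot> h"
    using targets_factor[OF AX f] .
  note k = triangleD(1)[OF *(4)] and h = triangleD(2)[OF *(4)]
  note g = triangleD(1)[OF *(5)] and r = triangleD(2)[OF *(5)] and c = triangleD(3)[OF *(5)]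
  note ob = triangleD(4-6)[OF *(4)] triangleD(5,6)[OF *(5)]
  have "f \<cdot> k = Zer D K X"
    using comp_assoc[OF k h g] *(6) triangle_comp_zero[OF *(4)] comp_zero_right[OF ob(1) g] by simp
  then have "k \<cdot> Ident D K = Zer D K A" using mono[OF *(1) k] comp_ident_right[OF k] by simp
  then have "Ident D K = Zer D K K"
    using conflation_mono[OF *(4) targets_in_E[OF *(1)] targets_in_E[OF *(2)] ident_hom[OF ob(1)]] by blast
  then have "zero_object D K" using ob zero_object_iff by blast
  then have "is_iso D A I h"
    using iso_if_cone_zero[OF triangle_rotate[OF *(4)]] shift_zero_object by blast
  then obtain h' where h': "h' \<in> Hom D I A" "h' \<cdot> h = Ident D A" "h \<cdot> h' = Ident D I"
    unfolding is_iso_def by blast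
  have "is_iso D I A h'" unfolding is_iso_def using h h' by blast
  moreover have i: "is_iso D V V (Ident D V)" if "V \<in> Obj D" for V
    unfolding is_iso_def using that ident_hom comp_ident_left by blast
  moreover have "f \<cdot> h' = g"
    using comp_assoc[OF h'(1) h g] *(6) h'(3) comp_ident_right[OF g] by simp
  moreover have sc: "ShM D 1 h' \<cdot> c \<in> Hom D Q (ShO D 1 A)"
    using comp_hom[OF c shift_hom[OF h'(1)]] .
  ultimately have "triangle D A X Q f r (ShM D 1 h' \<cdot> c)"
    by (intro TR1_iso[OF *(5), of A X Q f r "ShM D 1 h' \<cdot> c" h' "Ident D X" "Ident D Q"])
      (use f r ob in \<open>simp_all add: candidate_def triangle_morphism_def comp_ident_left[OF g]
        comp_ident_left[OF r] comp_ident_right[OF r] comp_ident_right[OF sc]\<close>)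
  then show ?thesis using that *(3) by blast
qed

text \<open>Here the cokernel vanishes, so that \<open>I \<rightarrow> X\<close> is the isomorphism along which a triangle is moved.\<close>

lemma epi_triangle:
  assumes AX: "A \<in> M" "X \<in> M" and f: "f \<in> Hom D A X"
    and epi: "\<And>W u. \<lbrakk>W \<in> M; u \<in> Hom D X W; u \<cdot> f = Zer D A W\<rbrakk> \<Longrightarrow> u = Zer D X W"
  obtains K k p where "K \<in> M" "triangle D K A X k f p"
proof -
  obtain K I Q k h p g r c where *: "K \<in> M" "I \<in> M" "Q \<in> M"
    "triangle D K A I k h p" "triangle D I X Q g r c" "f = g \<cdot> h"
    using targets_factor[OF AX f] .
  note k = triangleD(1)[OF *(4)] and h = triangleD(2)[OF *(4)] and p = triangleD(3)[OF *(4)]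
  note g = triangleD(1)[OF *(5)] and r = triangleD(2)[OF *(5)]
  note ob = triangleD(4-6)[OF *(4)] triangleD(5,6)[OF *(5)]
  have "r \<cdot> f = Zer D A Q"
    using comp_assoc[OF h g r] *(6) triangle_comp_zero[OF *(5)] comp_zero_left[OF h ob(5)] by simp
  then have "Ident D Q \<cdot> r = Zer D X Q" using epi[OF *(3) r] comp_ident_left[OF r] by simp
  then have "Ident D Q = Zer D Q Q"
    using conflation_epi[OF *(5) targets_in_E[OF *(3)] targets_in_E[OF *(2)] ident_hom[OF ob(5)]] by blast
  then have "zero_object D Q" using ob zero_object_iff by blast
  then have gi: "is_iso D I X g" using iso_if_cone_zero[OF *(5)] by blast
  then obtain g' where g': "g' \<in> Hom D X I" "g' \<cdot> g = Ident D I"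
    unfolding is_iso_def by blast
  have i: "is_iso D V V (Ident D V)" if "V \<in> Obj D" for V
    unfolding is_iso_def using that ident_hom comp_ident_left by blast
  have pg: "(p \<cdot> g') \<cdot> g = p"
    using comp_assoc[OF g g'(1) p] g'(2) comp_ident_right[OF p] by simp
  have pg': "p \<cdot> g' \<in> Hom D X (ShO D 1 K)" using comp_hom[OF g'(1) p] .
  have "triangle D K A X k f (p \<cdot> g')"
    by (rule TR1_iso[OF *(4) _ i[OF ob(1)] i[OF ob(2)] gi])
      (use f k ob pg' in \<open>simp_all add: candidate_def triangle_morphism_def comp_ident_left[OF k]
        comp_ident_right[OF k] comp_ident_right[OF f] *(6)[symmetric] shift_ident comp_ident_left[OF p] pg\<close>)
  then show ?thesis using that *(1) by blast
qed

lemma targets_abelian: "abelian_category (full_sub D M)"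
proof -
  interpret F: additive_category "full_sub D M"
    using full_sub_additive[OF targets_subcategory targets_extension_closed] .
  have arr: "\<exists>A X. A \<in> M \<and> X \<in> M \<and> f \<in> Hom D A X" if "f \<in> Arr (full_sub D M)" for f
    using that by (auto simp: full_sub_Arr Hom_def)
  show ?thesis
  proof
    show "\<exists>k. is_kernel (full_sub D M) k f" if "f \<in> Arr (full_sub D M)" for f
      using arr[OF that] targets_kernel by blast
    show "\<exists>c. is_cokernel (full_sub D M) c f" if "f \<in> Arr (full_sub D M)" for f
      using arr[OF that] targets_cokernel by blast
  next
    fix f assume m: "monic (full_sub D M) f"
    then obtain A X where f: "A \<in> M" "X \<in> M" "f \<in> Hom D A X" using arr unfolding monic_def by blast
    have "u = Zer D W A" if u: "W \<in> M" "u \<in> Hom D W A" "f \<cdot> u = Zer D W X" for W u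
    proof -
      have "W \<in> Obj D" using u targets_obj by blast
      then have "Zer D W A \<in> Hom D W A" "f \<cdot> u = f \<cdot> Zer D W A"
        using zero_hom comp_zero_right[OF _ f(3)] f targets_obj u(3) by auto
      then show ?thesis using monic_full_sub[OF targets_obj m f(3) u(1) f(1) u(2)] by blast
    qed
    then obtain Q r c where "Q \<in> M" "triangle D A X Q f r c" using mono_triangle[OF f] by blast
    then show "\<exists>g. is_kernel (full_sub D M) f g" using conflation_kernel f by blast
  next
    fix f assume m: "epic (full_sub D M) f"
    then obtain A X where f: "A \<in> M" "X \<in> M" "f \<in> Hom D A X" using arr unfolding epic_def by blast
    have "u = Zer D X W" if u: "W \<in> M" "u \<in> Hom D X W" "u \<cdot> f = Zer D A W" for W u
    proof -
      have "W \<in> Obj D" using u targets_obj by blast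
      then have "Zer D X W \<in> Hom D X W" "u \<cdot> f = Zer D X W \<cdot> f"
        using zero_hom comp_zero_left[OF f(3)] f targets_obj u(3) by auto
      then show ?thesis using epic_full_sub[OF targets_obj m f(3) u(1) f(2) u(2)] by blast
    qed
    then obtain K k p where "K \<in> M" "triangle D K A X k f p" using epi_triangle[OF f] by blast
    then show "\<exists>g. is_cokernel (full_sub D M) f g" using conflation_cokernel f by blast
  qed
qed

lemma short_exact_if_triangle:
  assumes t: "triangle D X Y Z f g h" and M: "X \<in> M" "Y \<in> M" "Z \<in> M"
  shows "short_exact (full_sub D M) X Y Z f g"
proof -
  note o = triangleD[OF t]
  obtain N where N: "zero_object D N" using has_zero_object by blast
  have NM: "N \<in> M" using targets_zero[OF N] .
  have NO: "N \<in> Obj D" using NM targets_obj by blast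
  have NX: "Zer D N X \<in> Hom D N X" and ZN: "Zer D Z N \<in> Hom D Z N" using NO o zero_hom by auto
  note idX = ident_hom[OF o(4)] and idZ = ident_hom[OF o(6)]
  have "is_kernel (full_sub D M) (Zer D N X) f"
    unfolding is_kernel_full_sub[OF targets_obj NX o(1) NM M(1,2)]
  proof (intro conjI ballI impI)
    show "f \<cdot> Zer D N X = Zer D N Y" using comp_zero_right[OF NO o(1)] .
    fix W u assume W: "W \<in> M" and u: "u \<in> Hom D W X" "f \<cdot> u = Zer D W Y"
    then have "u = Zer D W X" using conflation_mono[OF t targets_in_E[OF W] targets_in_E[OF M(3)]] by blast
    moreover have WO: "W \<in> Obj D" using W targets_obj by blast
    ultimately show "\<exists>!v. v \<in> Hom D W N \<and> Zer D N X \<cdot> v = u"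
      using zero_hom[OF WO NO] comp_zero_right[OF WO NX] zero_object_homs(2)[OF N] by metis
  qed
  moreover have "is_cokernel (full_sub D M) (Ident D X) (Zer D N X)"
    unfolding is_cokernel_full_sub[OF targets_obj idX NX M(1) NM M(1)]
    using comp_ident_left[OF NX] comp_ident_right by metis
  moreover have "is_kernel (full_sub D M) (Zer D N X) (Ident D X)"
    unfolding is_kernel_full_sub[OF targets_obj NX idX NM M(1,1)]
  proof (intro conjI ballI impI)
    show "Ident D X \<cdot> Zer D N X = Zer D N X" using comp_ident_left[OF NX] .
    fix W u assume W: "W \<in> M" and u: "u \<in> Hom D W X" "Ident D X \<cdot> u = Zer D W X"
    then have "u = Zer D W X" using comp_ident_left[OF u(1)] by simp
    moreover have WO: "W \<in> Obj D" using W targets_obj by blast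
    ultimately show "\<exists>!v. v \<in> Hom D W N \<and> Zer D N X \<cdot> v = u"
      using zero_hom[OF WO NO] comp_zero_right[OF WO NX] zero_object_homs(2)[OF N] by metis
  qed
  ultimately have 1: "exact_at (full_sub D M) (Zer D N X) f"
    unfolding exact_at_def is_image_def by blast
  have 2: "exact_at (full_sub D M) f g"
    unfolding exact_at_def is_image_def using conflation_kernel[OF t M] conflation_cokernel[OF t M] by blast
  have "is_cokernel (full_sub D M) (Zer D Z N) g"
    unfolding is_cokernel_full_sub[OF targets_obj ZN o(2) NM M(2,3)]
  proof (intro conjI ballI impI)
    show "Zer D Z N \<cdot> g = Zer D Y N" using comp_zero_left[OF o(2) NO] .
    fix W u assume W: "W \<in> M" and u: "u \<in> Hom D Z W" "u \<cdot> g = Zer D Y W"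
    then have "u = Zer D Z W" using conflation_epi[OF t targets_in_E[OF W] targets_in_E[OF M(1)]] by blast
    moreover have WO: "W \<in> Obj D" using W targets_obj by blast
    ultimately show "\<exists>!v. v \<in> Hom D N W \<and> v \<cdot> Zer D Z N = u"
      using zero_hom[OF NO WO] comp_zero_left[OF ZN WO] zero_object_homs(1)[OF N] by metis
  qed
  moreover have "is_kernel (full_sub D M) (Ident D Z) (Zer D Z N)"
    unfolding is_kernel_full_sub[OF targets_obj idZ ZN M(3,3) NM]
    using comp_ident_right[OF ZN] comp_ident_left by metis
  ultimately have 3: "exact_at (full_sub D M) g (Zer D Z N)"
    unfolding exact_at_def is_image_def by blast
  show ?thesis
    unfolding short_exact_def using o M 1 2 3 N NM
    by (auto simp: full_sub_Hom[OF targets_obj] full_sub_zero_object[OF targets_obj])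
qed

text \<open>Exactness at the two ends makes \<open>f\<close> a monomorphism and \<open>g\<close> an epimorphism, so that \<open>g\<close> is part of a triangle
\<open>K \<rightarrow> Y \<rightarrow> Z\<close>.  Exactness in the middle makes \<open>f\<close>, like \<open>K \<rightarrow> Y\<close>, a kernel of \<open>g\<close>, and
the comparison \<open>K \<rightarrow> X\<close> turns this triangle into one on \<open>f\<close> and \<open>g\<close>.\<close>

lemma triangle_if_short_exact:
  assumes se: "short_exact (full_sub D M) X Y Z f g"
  shows "\<exists>h. triangle D X Y Z f g h"
proof -
  have f: "f \<in> Hom D X Y" and g: "g \<in> Hom D Y Z" and M: "X \<in> M" "Y \<in> M" "Z \<in> M"
    using se by (auto simp: short_exact_def full_sub_Hom[OF targets_obj])
  have ob: "X \<in> Obj D" "Y \<in> Obj D" "Z \<in> Obj D" using M targets_obj by auto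
  obtain N where NM: "N \<in> M" and N: "zero_object D N"
    and ex: "exact_at (full_sub D M) (Zer D N X) f" "exact_at (full_sub D M) f g"
      "exact_at (full_sub D M) g (Zer D Z N)"
    using se by (auto simp: short_exact_def full_sub_zero_object[OF targets_obj])
  have NO: "N \<in> Obj D" using NM targets_obj by blast
  have NX: "Zer D N X \<in> Hom D N X" and ZN: "Zer D Z N \<in> Hom D Z N" using NO ob zero_hom by auto
  \<comment> \<open>A cokernel of \<open>0 \<rightarrow> X\<close> has a left inverse, so its kernel \<open>i\<close>, which is also a kernel of \<open>f\<close>, vanishes.\<close>
  have f_mono: "u = Zer D W X" if W: "W \<in> M" and u: "u \<in> Hom D W X" "f \<cdot> u = Zer D W Y" for W u
  proof -
    obtain i c where ic: "is_cokernel (full_sub D M) c (Zer D N X)" "is_kernel (full_sub D M) i c"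
        "is_kernel (full_sub D M) i f"
      using ex(1) unfolding exact_at_def is_image_def by blast
    obtain Q where c: "c \<in> Hom D X Q" "Q \<in> M" using is_cokernel_full_sub_arr[OF ic(1) NX] .
    obtain I where i: "i \<in> Hom D I X" "I \<in> M" using is_kernel_full_sub_arr[OF ic(2) c(1)] .
    have "Ident D X \<cdot> Zer D N X = Zer D N X" using comp_ident_left[OF NX] .
    then obtain w where w: "w \<in> Hom D Q X" "w \<cdot> c = Ident D X"
      using ic(1) ident_hom[OF ob(1)] M(1)
      unfolding is_cokernel_full_sub[OF targets_obj c(1) NX c(2) NM M(1)] by blast
    obtain v where v: "v \<in> Hom D W I" "i \<cdot> v = u"
      using ic(3) W u unfolding is_kernel_full_sub[OF targets_obj i(1) f i(2) M(1,2)] by blast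
    have "c \<cdot> i = Zer D I Q"
      using ic(2) unfolding is_kernel_full_sub[OF targets_obj i(1) c(1) i(2) M(1) c(2)] by blast
    moreover have "IO \<in> Obj D \<Longrightarrow> w \<cdot> Zer D IO Q = Zer D IO X" for IO using comp_zero_right[OF _ w(1)] .
    ultimately have "i = Zer D I X"
      using comp_assoc[OF i(1) c(1) w(1)] w(2) comp_ident_left[OF i(1)] i(2) targets_obj by auto
    then show ?thesis using v comp_zero_left[OF v(1) ob(1)] by simp
  qed
  \<comment> \<open>A kernel of \<open>Z \<rightarrow> 0\<close> has a right inverse and is a kernel of the cokernel \<open>c\<close> of \<open>g\<close>, so \<open>c\<close> vanishes.\<close>
  have g_epi: "u = Zer D Z W" if W: "W \<in> M" and u: "u \<in> Hom D Z W" "u \<cdot> g = Zer D Y W" for W u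
  proof -
    obtain i c where ic: "is_cokernel (full_sub D M) c g" "is_kernel (full_sub D M) i c"
        "is_kernel (full_sub D M) i (Zer D Z N)"
      using ex(3) unfolding exact_at_def is_image_def by blast
    obtain Q where c: "c \<in> Hom D Z Q" "Q \<in> M" using is_cokernel_full_sub_arr[OF ic(1) g] .
    obtain I where i: "i \<in> Hom D I Z" "I \<in> M" using is_kernel_full_sub_arr[OF ic(2) c(1)] .
    have "Zer D Z N \<cdot> Ident D Z = Zer D Z N" using comp_ident_right[OF ZN] .
    then obtain v where v: "v \<in> Hom D Z I" "i \<cdot> v = Ident D Z"
      using ic(3) ident_hom[OF ob(3)] M(3)
      unfolding is_kernel_full_sub[OF targets_obj i(1) ZN i(2) M(3) NM] by blast
    have "c \<cdot> i = Zer D I Q"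
      using ic(2) unfolding is_kernel_full_sub[OF targets_obj i(1) c(1) i(2) M(3) c(2)] by blast
    moreover have "Q \<in> Obj D" using c(2) targets_obj by blast
    ultimately have "c = Zer D Z Q"
      using comp_assoc[OF v(1) i(1) c(1)] v(2) comp_ident_right[OF c(1)] comp_zero_left[OF v(1)] by simp
    moreover obtain w where w: "w \<in> Hom D Q W" "w \<cdot> c = u"
      using ic(1) W u unfolding is_cokernel_full_sub[OF targets_obj c(1) g c(2) M(2,3)] by blast
    ultimately show ?thesis using comp_zero_right[OF ob(3) w(1)] by simp
  qed
  obtain Q0 c0 h0 where c0: "Q0 \<in> M" "triangle D X Y Q0 f c0 h0"
    using mono_triangle[OF M(1,2) f f_mono] .
  obtain K k p where K: "K \<in> M" "triangle D K Y Z k g p" using epi_triangle[OF M(2,3) g g_epi] .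
  have k: "k \<in> Hom D K Y" and p: "p \<in> Hom D Z (ShO D 1 K)" and KO: "K \<in> Obj D"
    using triangleD[OF K(2)] by auto
  obtain i c where ic: "is_cokernel (full_sub D M) c f" "is_kernel (full_sub D M) i c"
      "is_kernel (full_sub D M) i g"
    using ex(2) unfolding exact_at_def is_image_def by blast
  obtain Q where c: "c \<in> Hom D Y Q" "Q \<in> M" using is_cokernel_full_sub_arr[OF ic(1) f] .
  obtain I where i: "i \<in> Hom D I Y" "I \<in> M" using is_kernel_full_sub_arr[OF ic(2) c(1)] .
  note ic' = ic(1)[unfolded is_cokernel_full_sub[OF targets_obj c(1) f c(2) M(1,2)]]
    ic(2)[unfolded is_kernel_full_sub[OF targets_obj i(1) c(1) i(2) M(2) c(2)]]
    ic(3)[unfolded is_kernel_full_sub[OF targets_obj i(1) g i(2) M(2,3)]]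
  \<comment> \<open>Both \<open>f\<close> and \<open>k\<close> factor through the common kernel \<open>i\<close> of \<open>c\<close> and \<open>g\<close>.\<close>
  obtain v where v: "v \<in> Hom D X I" "i \<cdot> v = f" using ic'(1,2) f M(1) by blast
  have gf: "g \<cdot> f = Zer D X Z"
    using comp_assoc[OF v(1) i(1) g] v(2) ic'(3) comp_zero_left[OF v(1) ob(3)] by simp
  obtain a where a: "a \<in> Hom D X K" "k \<cdot> a = f" using triangle_lift[OF K(2) f gf] .
  obtain v' where v': "v' \<in> Hom D K I" "i \<cdot> v' = k"
    using ic'(3) k K(1) triangle_comp_zero[OF K(2)] by blast
  have QO: "Q \<in> Obj D" "Q0 \<in> Obj D" using c(2) c0(1) targets_obj by auto
  have "c \<cdot> k = Zer D K Q"
    using comp_assoc[OF v'(1) i(1) c(1)] v'(2) ic'(2) comp_zero_left[OF v'(1) QO(1)] by simp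
  moreover obtain w where w: "w \<in> Hom D Q Q0" "w \<cdot> c = c0"
    using ic'(1) triangleD(2)[OF c0(2)] triangle_comp_zero[OF c0(2)] c0(1) by blast
  ultimately have "c0 \<cdot> k = Zer D K Q0"
    using comp_assoc[OF k c(1) w(1)] comp_zero_right[OF KO w(1)] by simp
  then obtain b where b: "b \<in> Hom D K X" "f \<cdot> b = k" using triangle_lift[OF c0(2) k] by blast
  note idX = ident_hom[OF ob(1)] and idK = ident_hom[OF KO]
  have "f \<cdot> (b \<cdot> a) = f \<cdot> Ident D X" using comp_assoc[OF a(1) b(1) f] a b comp_ident_right[OF f] by simp
  then have ba: "b \<cdot> a = Ident D X"
    using cancel_left[OF f comp_hom[OF a(1) b(1)] idX] f_mono[OF M(1)] by blast
  have "k \<cdot> (a \<cdot> b) = k \<cdot> Ident D K" using comp_assoc[OF b(1) a(1) k] a b comp_ident_right[OF k] by simp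
  then have ab: "a \<cdot> b = Ident D K"
    using cancel_left[OF k comp_hom[OF b(1) a(1)] idK] conflation_mono[OF K(2) targets_in_E[OF K(1)] targets_in_E[OF M(3)]]
    by blast
  have "is_iso D K X b" unfolding is_iso_def using a b ab ba by blast
  moreover have "is_iso D V V (Ident D V)" if "V \<in> Obj D" for V
    unfolding is_iso_def using that ident_hom comp_ident_left by blast
  moreover have bp: "ShM D 1 b \<cdot> p \<in> Hom D Z (ShO D 1 X)" using comp_hom[OF p shift_hom[OF b(1)]] .
  ultimately have "triangle D X Y Z f g (ShM D 1 b \<cdot> p)"
    by (intro TR1_iso[OF K(2), of X Y Z f g "ShM D 1 b \<cdot> p" b "Ident D Y" "Ident D Z"])
      (use ob f g b(2) in \<open>simp_all add: candidate_def triangle_morphism_def comp_ident_left[OF k]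
        comp_ident_left[OF g] comp_ident_right[OF g] comp_ident_right[OF bp]\<close>)
  then show ?thesis by blast
qed

end

section \<open>Aisles and coaisles\<close>

context triangulated_category
begin

lemma Hom_zero_from_extension:
  assumes t: "triangle_on D X Y Z" and "Hom_zero D X W" "Hom_zero D Z W" "W \<in> Obj D"
  shows "Hom_zero D Y W"
proof (rule Hom_zeroI)
  obtain f g h where t': "triangle D X Y Z f g h" using t unfolding triangle_on_def by blast
  show "Y \<in> Obj D" "W \<in> Obj D" using triangle_on_obj[OF t] assms by auto
  fix u assume u: "u \<in> Hom D Y W"
  have "u \<cdot> f = Zer D X W" using Hom_zeroD[OF assms(2) comp_hom[OF triangleD(1)[OF t'] u]] .
  then obtain v where v: "v \<in> Hom D Z W" "v \<cdot> g = u" using triangle_descend[OF t' u] by blast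
  show "u = Zer D Y W"
    using Hom_zeroD[OF assms(3) v(1)] v(2) comp_zero_left[OF triangleD(2)[OF t'] assms(4)] by simp
qed

lemma Hom_zero_to_extension:
  assumes t: "triangle_on D X Y Z" and "Hom_zero D W X" "Hom_zero D W Z" "W \<in> Obj D"
  shows "Hom_zero D W Y"
proof (rule Hom_zeroI)
  obtain f g h where t': "triangle D X Y Z f g h" using t unfolding triangle_on_def by blast
  show "Y \<in> Obj D" "W \<in> Obj D" using triangle_on_obj[OF t] assms by auto
  fix u assume u: "u \<in> Hom D W Y"
  have "g \<cdot> u = Zer D W Z" using Hom_zeroD[OF assms(3) comp_hom[OF u triangleD(2)[OF t']]] .
  then obtain v where v: "v \<in> Hom D W X" "f \<cdot> v = u" using triangle_lift[OF t' u] by blast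
  show "u = Zer D W Y"
    using Hom_zeroD[OF assms(2) v(1)] v(2) comp_zero_right[OF assms(4) triangleD(1)[OF t']] by simp
qed

lemma triangle_on_from_ident:
  assumes "X \<in> Obj D" "zero_object D N"
  shows "triangle_on D X X N" "triangle_on D X N (ShO D 1 X)"
  using TR1_ident[OF assms] triangle_on_rotate unfolding triangle_on_def by blast+

lemma triangle_on_zero_left:
  assumes X: "X \<in> Obj D" and N: "zero_object D N"
  shows "triangle_on D N X X"
proof -
  have "zero_object D (ShO D 1 N)" "N \<in> Obj D"
    using N shift_zero_object zero_object_iff by auto
  then show ?thesis
    using triangle_on_rotate_back[OF triangle_on_from_ident(1)[OF X, of "ShO D 1 N"]]
    by (simp add: shift_simps)
qed

lemma isomorphic_sym: "isomorphic D X Y \<Longrightarrow> isomorphic D Y X"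
  unfolding isomorphic_def is_iso_def by blast

lemma shift_isomorphic:
  assumes "isomorphic D X Y" shows "isomorphic D (ShO D n X) (ShO D n Y)"
proof -
  obtain f g where fg: "f \<in> Hom D X Y" "g \<in> Hom D Y X" "g \<cdot> f = Ident D X" "f \<cdot> g = Ident D Y"
    using assms unfolding isomorphic_def is_iso_def by blast
  have "X \<in> Obj D" "Y \<in> Obj D" using fg hom_dom_obj by blast+
  then have "ShM D n g \<cdot> ShM D n f = Ident D (ShO D n X)" "ShM D n f \<cdot> ShM D n g = Ident D (ShO D n Y)"
    using shift_comp[OF fg(1,2), of n] shift_comp[OF fg(2,1), of n] fg(3,4) shift_ident by simp_all
  then show ?thesis
    unfolding isomorphic_def is_iso_def using shift_hom[OF fg(1)] shift_hom[OF fg(2)] by blast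
qed

end

locale t_structured_category = triangulated_category D
  for D :: "('o, 'm, 'x) tricat_scheme" (structure) +
  fixes L G :: "'o set"
  assumes t_struct: "t_structure D L G"
begin

abbreviation "aisle \<equiv> D_le D L"
abbreviation "coaisle \<equiv> D_ge D G"

lemma aisles_in_obj: "L \<subseteq> Obj D" "G \<subseteq> Obj D"
  using t_struct unfolding t_structure_def subcategory_def by blast+

lemma aisles_iso_closed:
  assumes "isomorphic D X Y" "Y \<in> Obj D"
  shows "X \<in> L \<Longrightarrow> Y \<in> L" "X \<in> G \<Longrightarrow> Y \<in> G"
proof -
  have s: "subcategory D L" "subcategory D G" using t_struct unfolding t_structure_def by simp_all
  show "X \<in> L \<Longrightarrow> Y \<in> L" "X \<in> G \<Longrightarrow> Y \<in> G"
    using s assms unfolding subcategory_def by simp_all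
qed

lemma aisle_iff: "X \<in> aisle n \<longleftrightarrow> X \<in> Obj D \<and> ShO D n X \<in> L"
proof
  assume "X \<in> aisle n"
  then obtain A where "A \<in> L" "X = ShO D (- n) A" unfolding D_le_def by blast
  then show "X \<in> Obj D \<and> ShO D n X \<in> L" using aisles_in_obj by (auto simp: shift_simps)
next
  assume "X \<in> Obj D \<and> ShO D n X \<in> L"
  moreover from this have "X = ShO D (- n) (ShO D n X)" by (simp add: shift_simps)
  ultimately show "X \<in> aisle n" unfolding D_le_def by blast
qed

lemma coaisle_iff: "X \<in> coaisle n \<longleftrightarrow> X \<in> Obj D \<and> ShO D n X \<in> G"
proof
  assume "X \<in> coaisle n"
  then obtain A where "A \<in> G" "X = ShO D (- n) A" unfolding D_ge_def by blast
  then show "X \<in> Obj D \<and> ShO D n X \<in> G" using aisles_in_obj by (auto simp: shift_simps)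
next
  assume "X \<in> Obj D \<and> ShO D n X \<in> G"
  moreover from this have "X = ShO D (- n) (ShO D n X)" by (simp add: shift_simps)
  ultimately show "X \<in> coaisle n" unfolding D_ge_def by blast
qed

lemma shift_aisle: "X \<in> Obj D \<Longrightarrow> ShO D k X \<in> aisle n \<longleftrightarrow> X \<in> aisle (n + k)"
  by (simp add: aisle_iff shift_simps)

lemma shift_coaisle: "X \<in> Obj D \<Longrightarrow> ShO D k X \<in> coaisle n \<longleftrightarrow> X \<in> coaisle (n + k)"
  by (simp add: coaisle_iff shift_simps)

lemma aisle_mono:
  assumes "X \<in> aisle m" "m \<le> n" shows "X \<in> aisle n"
  using assms(2)
proof (induction n rule: int_ge_induct)
  case base show ?case by (rule assms(1))
next
  case (step n)
  have X: "X \<in> Obj D" using assms aisle_iff by blast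
  have "ShO D n X \<in> aisle 0" using step.IH shift_aisle[OF X, of n 0] by simp
  then have "ShO D n X \<in> aisle 1" using t_struct unfolding t_structure_def by blast
  then show ?case using shift_aisle[OF X, of n 1] by (simp add: add.commute)
qed

lemma coaisle_antimono:
  assumes "X \<in> coaisle m" "n \<le> m" shows "X \<in> coaisle n"
  using assms(2)
proof (induction n rule: int_le_induct)
  case base show ?case by (rule assms(1))
next
  case (step n)
  have X: "X \<in> Obj D" using assms coaisle_iff by blast
  have "ShO D (n - 1) X \<in> coaisle 1" using step.IH shift_coaisle[OF X, of "n - 1" 1] by simp
  then have "ShO D (n - 1) X \<in> coaisle 0" using t_struct unfolding t_structure_def by blast
  then show ?case using shift_coaisle[OF X, of "n - 1" 0] by simp
qed

lemma aisle_coaisle_orthogonal: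
  assumes "X \<in> aisle m" "Y \<in> coaisle n" "m < n" shows "Hom_zero D X Y"
proof -
  have X: "X \<in> Obj D" and Y: "Y \<in> Obj D" using assms aisle_iff coaisle_iff by blast+
  have "Y \<in> coaisle (1 + m)" using coaisle_antimono[OF assms(2)] assms(3) by simp
  then have "ShO D m X \<in> aisle 0" "ShO D m Y \<in> coaisle 1"
    using shift_aisle[OF X, of m 0] shift_coaisle[OF Y, of m 1] assms by simp_all
  then have "Hom_zero D (ShO D m X) (ShO D m Y)" using t_struct unfolding t_structure_def by blast
  then show ?thesis using Hom_zero_shift[OF X Y] by blast
qed

lemma truncation:
  assumes X: "X \<in> Obj D"
  obtains A B where "A \<in> aisle n" "B \<in> coaisle (n + 1)" "triangle_on D A X B"
proof -
  obtain A B where AB: "A \<in> aisle 0" "B \<in> coaisle 1" "triangle_on D A (ShO D n X) B"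
    using t_struct shift_obj[OF X] unfolding t_structure_def by blast
  have "A \<in> Obj D" "B \<in> Obj D" using triangle_on_obj[OF AB(3)] by auto
  then have "ShO D (- n) A \<in> aisle n" "ShO D (- n) B \<in> coaisle (n + 1)"
    using AB shift_aisle shift_coaisle by simp_all
  moreover have "triangle_on D (ShO D (- n) A) X (ShO D (- n) B)"
    using triangle_on_shift[OF AB(3), of "- n"] X by (simp add: shift_simps)
  ultimately show ?thesis using that by blast
qed

text \<open>In the truncation triangle \<open>A \<rightarrow> X \<rightarrow> B\<close> the second morphism vanishes, so the identity of \<open>B\<close> factors
through \<open>A[1]\<close>, which has no morphisms to \<open>B\<close>.  Hence \<open>B\<close> is zero and \<open>A \<rightarrow> X\<close> is an isomorphism.\<close>

lemma aisle_if_orthogonal: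
  assumes X: "X \<in> Obj D" and orth: "\<And>Y. Y \<in> coaisle (n + 1) \<Longrightarrow> Hom_zero D X Y"
  shows "X \<in> aisle n"
proof -
  obtain A B where AB: "A \<in> aisle n" "B \<in> coaisle (n + 1)" and "triangle_on D A X B" using truncation[OF X] .
  then obtain a b c where t: "triangle D A X B a b c" unfolding triangle_on_def by blast
  note o = triangleD[OF t]
  have "Ident D B \<cdot> b = Zer D X B"
    using Hom_zeroD[OF orth[OF AB(2)] o(2)] comp_ident_left[OF o(2)] by simp
  then obtain v where v: "v \<in> Hom D (ShO D 1 A) B" "v \<cdot> c = Ident D B"
    using triangle_descend[OF triangle_rotate[OF t] ident_hom[OF o(6)]] by blast
  have "ShO D 1 A \<in> aisle (n - 1)" using shift_aisle[OF o(4)] AB(1) by simp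
  then have "Hom_zero D (ShO D 1 A) B" using aisle_coaisle_orthogonal[OF _ AB(2)] by simp
  then have "Ident D B = Zer D B B"
    using v(2) Hom_zeroD[OF _ v(1)] comp_zero_left[OF o(3,6)] by simp
  then have "zero_object D B" using zero_object_iff o(6) by simp
  then have "isomorphic D A X" using iso_if_cone_zero[OF t] unfolding isomorphic_def by blast
  then have "isomorphic D (ShO D n A) (ShO D n X)" by (rule shift_isomorphic)
  then have "ShO D n X \<in> L"
    using aisles_iso_closed(1) AB(1) shift_obj[OF X] aisle_iff by simp
  then show ?thesis using X aisle_iff by blast
qed

text \<open>Dually, the identity of \<open>A\<close> factors through \<open>B[-1]\<close>.\<close>

lemma coaisle_if_orthogonal:
  assumes Y: "Y \<in> Obj D" and orth: "\<And>X. X \<in> aisle n \<Longrightarrow> Hom_zero D X Y"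
  shows "Y \<in> coaisle (n + 1)"
proof -
  obtain A B where AB: "A \<in> aisle n" "B \<in> coaisle (n + 1)" and "triangle_on D A Y B" using truncation[OF Y] .
  then obtain a b c where t: "triangle D A Y B a b c" unfolding triangle_on_def by blast
  note o = triangleD[OF t] and t' = triangle_rotate_back[OF t]
  have "a \<cdot> Ident D A = Zer D A Y"
    using Hom_zeroD[OF orth[OF AB(1)] o(1)] comp_ident_right[OF o(1)] by simp
  then obtain v where v: "v \<in> Hom D A (ShO D (- 1) B)" "Neg D (ShM D (- 1) c) \<cdot> v = Ident D A"
    using triangle_lift[OF t' ident_hom[OF o(4)]] by blast
  have "ShO D (- 1) B \<in> coaisle (n + 2)" using shift_coaisle[OF o(6), of "- 1" "n + 2"] AB(2) by (simp add: add.commute)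
  then have "Hom_zero D A (ShO D (- 1) B)" using aisle_coaisle_orthogonal[OF AB(1)] by simp
  then have "Ident D A = Zer D A A"
    using v(2) Hom_zeroD[OF _ v(1)] comp_zero_right[OF o(4) triangleD(1)[OF t']] by simp
  then have "zero_object D (ShO D 1 A)" using shift_zero_object zero_object_iff o(4) by simp
  then have "isomorphic D Y B" using iso_if_cone_zero[OF triangle_rotate[OF t]] unfolding isomorphic_def by blast
  then have "isomorphic D (ShO D (n + 1) B) (ShO D (n + 1) Y)" by (rule shift_isomorphic[OF isomorphic_sym])
  then have "ShO D (n + 1) Y \<in> G"
    using aisles_iso_closed(2) AB(2) shift_obj[OF Y] coaisle_iff by simp
  then show ?thesis using Y coaisle_iff by blast
qed

lemma aisle_extension:
  assumes t: "triangle_on D X Y Z" and "X \<in> aisle n" "Z \<in> aisle n" shows "Y \<in> aisle n"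
proof (rule aisle_if_orthogonal)
  show "Y \<in> Obj D" using triangle_on_obj[OF t] by blast
  show "Hom_zero D Y W" if "W \<in> coaisle (n + 1)" for W
    using Hom_zero_from_extension[OF t] aisle_coaisle_orthogonal[OF assms(2) that] aisle_coaisle_orthogonal[OF assms(3) that]
      that coaisle_iff by simp
qed

lemma coaisle_extension:
  assumes t: "triangle_on D X Y Z" and "X \<in> coaisle n" "Z \<in> coaisle n" shows "Y \<in> coaisle n"
proof -
  have "Y \<in> coaisle ((n - 1) + 1)"
  proof (rule coaisle_if_orthogonal)
    show "Y \<in> Obj D" using triangle_on_obj[OF t] by blast
    show "Hom_zero D W Y" if "W \<in> aisle (n - 1)" for W
      using Hom_zero_to_extension[OF t] aisle_coaisle_orthogonal[OF that assms(2)] aisle_coaisle_orthogonal[OF that assms(3)]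
        that aisle_iff by simp
  qed
  then show ?thesis by simp
qed

end

section \<open>Subcategories closed under d-factors and extensions\<close>

locale d_FAE_category = t_structured_category D L G
  for D :: "('o, 'm, 'x) tricat_scheme" (structure) and L G :: "'o set" +
  fixes T :: "'o set" and d :: nat
  assumes d_pos: "d \<ge> 1"
    and FAE: "d_FAE_closed D L G d T"
begin

abbreviation "heart \<equiv> D_interval D L G (- int d + 1) 0"

lemma heart_iff: "X \<in> heart \<longleftrightarrow> X \<in> aisle 0 \<and> X \<in> coaisle (- int d + 1)"
  by (simp add: D_interval_def)

lemma T_heart: "T \<subseteq> heart" and T_obj: "X \<in> T \<Longrightarrow> X \<in> Obj D"
  and T_zero: "zero_object D N \<Longrightarrow> N \<in> T"
  and T_factor: "d_factor D L G d T Z \<Longrightarrow> Z \<in> T"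
  and T_extension: "\<lbrakk>triangle_on D X Y Z; X \<in> T; Z \<in> T\<rbrakk> \<Longrightarrow> Y \<in> T"
  using FAE unfolding d_FAE_closed_def subcategory_def extension_closed_def by blast+

lemma in_T_if_resolution:
  fixes Zs Xs :: "nat \<Rightarrow> 'o"
  assumes heart: "\<And>i. i \<le> d \<Longrightarrow> Zs i \<in> heart"
    and T: "\<And>i. Xs i \<in> T"
    and tri: "\<And>i. i \<ge> 1 \<Longrightarrow> triangle_on D (Zs i) (Xs i) (Zs (i - 1))"
  shows "Zs 0 \<in> T"
proof (rule T_factor)
  have "\<forall>i \<in> {1..d}. Zs i \<in> heart \<and> Xs i \<in> T \<and> triangle_on D (Zs i) (Xs i) (Zs (i - 1))"
    using heart T tri by simp
  then show "d_factor D L G d T (Zs 0)"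
    unfolding d_factor_def using heart[of 0] by blast
qed

text \<open>The triangle on \<open>V\<close>, \<open>U\<close> and \<open>Q\<close> is a resolution of \<open>Q\<close> by objects of \<open>T\<close>, prolonged to length \<open>d\<close> by zeros.\<close>

lemma cone_in_T:
  assumes t: "triangle_on D V U Q" and T: "V \<in> T" "U \<in> T" and Q: "Q \<in> heart"
  shows "Q \<in> T"
proof -
  obtain N where N: "zero_object D N" using has_zero_object by blast
  define Zs :: "nat \<Rightarrow> 'o" where "Zs = (\<lambda>i. if i = 0 then Q else if i = 1 then V else N)"
  define Xs :: "nat \<Rightarrow> 'o" where "Xs = (\<lambda>i. if i \<le> 1 then U else Zs (i - 1))"
  have Zs: "Zs i \<in> T" if "i \<ge> 1" for i using that T T_zero[OF N] by (simp add: Zs_def)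
  have "Zs 0 \<in> T"
  proof (rule in_T_if_resolution[of Zs Xs])
    show "Zs i \<in> heart" for i using Zs[of i] Q T_heart by (cases i) (auto simp: Zs_def)
    show "Xs i \<in> T" for i using Zs[of "i - 1"] T by (simp add: Xs_def)
    fix i :: nat assume i: "i \<ge> 1"
    show "triangle_on D (Zs i) (Xs i) (Zs (i - 1))"
    proof (cases "i = 1")
      case True
      then show ?thesis using t by (simp add: Zs_def Xs_def)
    next
      case False
      then have e: "Zs i = N" "Xs i = Zs (i - 1)" and "i - 1 \<ge> 1" using i by (auto simp: Zs_def Xs_def)
      then show ?thesis unfolding e using triangle_on_zero_left[OF T_obj[OF Zs] N] by simp
    qed
  qed
  then show ?thesis by (simp add: Zs_def)
qed

text \<open>The object \<open>B[1]\<close> is the truncation of \<open>Y[1]\<close> to degrees at least \<open>-d+1\<close>.  Its resolution starts with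
\<open>B \<rightarrow> 0 \<rightarrow> B[1]\<close> and \<open>A \<rightarrow> Y \<rightarrow> B\<close>, and continues with \<open>A[-k-1] \<rightarrow> 0 \<rightarrow> A[-k]\<close>.  As \<open>A\<close> sits in the
single degree \<open>-d+1\<close>, the objects \<open>A\<close>, \<open>A[-1]\<close>, \<open>A[-2]\<close>, ... stay in degrees at most \<open>0\<close> for as many steps as
are needed.\<close>

lemma shifted_truncation_in_T:
  assumes Y: "Y \<in> T"
  obtains A B where "triangle_on D A Y B" "A \<in> aisle (- int d + 1)" "ShO D 1 B \<in> T"
proof -
  have Yh: "Y \<in> aisle 0" "Y \<in> coaisle (- int d + 1)" using Y T_heart heart_iff by auto
  obtain A B where A: "A \<in> aisle (- int d + 1)" and B: "B \<in> coaisle (- int d + 1 + 1)" and t: "triangle_on D A Y B"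
    using truncation[OF T_obj[OF Y]] .
  have ob: "A \<in> Obj D" "B \<in> Obj D" using triangle_on_obj[OF t] by auto
  have "ShO D (- 1) B \<in> coaisle (- int d + 1)"
    using shift_coaisle[OF ob(2)] coaisle_antimono[OF B] by simp
  then have A': "A \<in> coaisle (- int d + 1)" using coaisle_extension[OF triangle_on_rotate_back[OF t]] Yh by blast
  have "ShO D 1 A \<in> aisle 0" using shift_aisle[OF ob(1)] aisle_mono[OF A] d_pos by simp
  then have B': "B \<in> aisle 0" using aisle_extension[OF triangle_on_rotate[OF t]] Yh by blast
  obtain N where N: "zero_object D N" using has_zero_object by blast
  define Zs :: "nat \<Rightarrow> 'o" where
    "Zs = (\<lambda>i. if i = 0 then ShO D 1 B else if i = 1 then B else ShO D (2 - int i) A)"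
  define Xs :: "nat \<Rightarrow> 'o" where "Xs = (\<lambda>i. if i = 2 then Y else N)"
  have h: "Zs i \<in> heart" if "i \<le> d" for i
  proof -
    have "ShO D 1 B \<in> heart" "B \<in> heart"
      unfolding heart_iff using shift_aisle[OF ob(2)] shift_coaisle[OF ob(2)] aisle_mono[OF B'] B B' coaisle_antimono[OF B]
      by simp_all
    moreover have "ShO D (2 - int i) A \<in> heart" if "i \<ge> 2"
      unfolding heart_iff using shift_aisle[OF ob(1)] shift_coaisle[OF ob(1)] aisle_mono[OF A] coaisle_antimono[OF A'] that \<open>i \<le> d\<close>
      by simp
    ultimately show ?thesis by (simp add: Zs_def)
  qed
  have tri: "triangle_on D (Zs i) (Xs i) (Zs (i - 1))" if "i \<ge> 1" for i
  proof -
    have "i = 1 \<or> i = 2 \<or> i \<ge> 3" using that by linarith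
    then consider "i = 1" | "i = 2" | "i \<ge> 3" by blast
    then show ?thesis
    proof cases
      case 1
      then show ?thesis using triangle_on_from_ident(2)[OF ob(2) N] by (simp add: Zs_def Xs_def)
    next
      case 2
      then show ?thesis using t ob by (simp add: Zs_def Xs_def shift_simps)
    next
      case 3
      then have "i - Suc 0 \<noteq> Suc 0" by linarith
      then have "ShO D 1 (Zs i) = Zs (i - 1)" using 3 ob by (simp add: Zs_def shift_simps of_nat_diff)
      moreover have "Zs i \<in> Obj D" "Xs i = N" using 3 ob by (simp_all add: Zs_def Xs_def shift_obj)
      ultimately show ?thesis using triangle_on_from_ident(2)[OF _ N] by metis
    qed
  qed
  have "Xs i \<in> T" for i using Y T_zero[OF N] by (simp add: Xs_def)
  then have "Zs 0 \<in> T" using in_T_if_resolution[of Zs Xs] h tri by blast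
  then show ?thesis using that t A by (simp add: Zs_def)
qed

lemma W'_in_T: "X \<in> W' D T \<Longrightarrow> X \<in> T"
  by (simp add: W'_def)

text \<open>For degree reasons \<open>A\<close> has no morphisms to \<open>X[-n-2]\<close>, so a morphism from \<open>Y\<close> factors
through \<open>B\<close>, and morphisms \<open>B \<rightarrow> X[-n-2]\<close> are the same as morphisms \<open>B[1] \<rightarrow> X[-n-1]\<close>.\<close>

lemma negative_Hom_zero:
  assumes X: "X \<in> W' D T" and "Y \<in> T"
  shows "Hom_zero D Y (ShO D (- int (Suc n)) X)"
  using assms(2)
proof (induction n arbitrary: Y)
  case 0
  then show ?case using X by (simp add: W'_def)
next
  case (Suc n)
  let ?X = "ShO D (- int (Suc (Suc n))) X"
  have XO: "X \<in> Obj D" using X W'_in_T T_obj by blast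
  obtain A B where t: "triangle_on D A Y B" and A: "A \<in> aisle (- int d + 1)" and B: "ShO D 1 B \<in> T"
    using shifted_truncation_in_T[OF Suc.prems] .
  have "X \<in> coaisle (- int d + 1)" using W'_in_T[OF X] T_heart heart_iff by blast
  then have "?X \<in> coaisle (- int d + 2)" using shift_coaisle[OF XO] coaisle_antimono by simp
  then have "Hom_zero D A ?X" using aisle_coaisle_orthogonal[OF A] by simp
  moreover have "Hom_zero D B ?X"
    using Suc.IH[OF B] Hom_zero_shift[of B ?X 1] triangle_on_obj[OF t] XO by (simp add: shift_simps)
  ultimately show ?case using Hom_zero_from_extension[OF t] shift_obj[OF XO] by blast
qed

lemma W'_extension_closed: "extension_closed D (W' D T)"
  unfolding extension_closed_def
proof (intro ballI allI impI)
  fix X Z Y assume XZ: "X \<in> W' D T" "Z \<in> W' D T" and t: "triangle_on D X Y Z"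
  have "Hom_zero D W (ShO D (- 1) Y)" if "W \<in> T" for W
    using Hom_zero_to_extension[OF triangle_on_shift[OF t, of "- 1"]] XZ that T_obj[OF that]
    by (simp add: W'_def)
  then show "Y \<in> W' D T" using T_extension[OF t] XZ by (simp add: W'_def)
qed

lemma W'_subcategory: "subcategory D (W' D T)"
proof (rule subcategory_if_extension_closed[OF _ W'_extension_closed])
  show "W' D T \<subseteq> Obj D" using W'_in_T T_obj by blast
  fix N assume N: "zero_object D N"
  have "Hom_zero D Y (ShO D (- 1) N)" if "Y \<in> T" for Y
    using Hom_zeroI[OF T_obj[OF that]] zero_object_homs(2)[OF shift_zero_object[OF N]]
      shift_zero_object[OF N, of "- 1"] zero_object_iff by blast
  then show "N \<in> W' D T" using T_zero[OF N] by (simp add: W'_def)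
qed

text \<open>As the cone of \<open>V \<rightarrow> U\<close> the object \<open>Q\<close> is in the aisle and as the cocone of \<open>X \<rightarrow> Z\<close> in
the coaisle, so it is in \<open>T\<close>.  The second triangle also bounds \<open>Hom(T, Q[-1])\<close>, by
\<open>Hom(T, Z[-2])\<close> and \<open>Hom(T, X[-1])\<close>.\<close>

lemma W'_cone_and_cocone:
  assumes t: "triangle_on D V U Q" "triangle_on D Q X Z"
    and W: "V \<in> W' D T" "U \<in> W' D T" "X \<in> W' D T" "Z \<in> W' D T"
  shows "Q \<in> W' D T"
proof -
  have h: "V \<in> aisle 0" "U \<in> aisle 0" "X \<in> coaisle (- int d + 1)" "Z \<in> coaisle (- int d + 1)"
    using W W'_in_T T_heart heart_iff by blast+
  have ob: "V \<in> Obj D" "Z \<in> Obj D" using triangle_on_obj t by blast+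
  note t' = triangle_on_rotate_back[OF t(2)]
  have "ShO D 1 V \<in> aisle 0" "ShO D (- 1) Z \<in> coaisle (- int d + 1)"
    using shift_aisle[OF ob(1)] shift_coaisle[OF ob(2)] aisle_mono[OF h(1)] coaisle_antimono[OF h(4)] by simp_all
  then have "Q \<in> heart"
    using aisle_extension[OF triangle_on_rotate[OF t(1)]] coaisle_extension[OF t'] h heart_iff by blast
  then have "Q \<in> T" using cone_in_T[OF t(1)] W W'_in_T by blast
  moreover have "Hom_zero D Y (ShO D (- 1) Q)" if "Y \<in> T" for Y
    using Hom_zero_to_extension[OF triangle_on_shift[OF t', of "- 1"]] T_obj[OF that] ob
      negative_Hom_zero[OF W(4) that, of 1] negative_Hom_zero[OF W(3) that, of 0]
    by (simp add: shift_simps)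
  ultimately show ?thesis by (simp add: W'_def)
qed

sublocale W'_exact: negative_free_exact D "W' D T"
proof unfold_locales
  show "subcategory D (W' D T)" by (rule W'_subcategory)
  show "extension_closed D (W' D T)" by (rule W'_extension_closed)
  show "Hom_zero D X (ShO D (- 1) Y)" if "X \<in> W' D T" "Y \<in> W' D T" for X Y
    using negative_Hom_zero[OF that(2) W'_in_T[OF that(1)], of 0] by simp
  show "Q \<in> W' D T"
    if "triangle_on D V U Q" "triangle_on D Q X Z"
      "V \<in> W' D T" "U \<in> W' D T" "X \<in> W' D T" "Z \<in> W' D T" for V U Q X Z
    by (rule W'_cone_and_cocone[OF that])
qed

lemma W''_eq: "W'' D T = admissible_targets D (W' D T)"
  by (simp add: W''_def admissible_targets_def)

lemma W''_wide: "wide_subcategory D L G d (W'' D T)"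
  unfolding wide_subcategory_def W''_eq
proof (intro conjI ballI allI impI)
  let ?M = "admissible_targets D (W' D T)"
  show "subcategory D ?M" by (rule W'_exact.targets_subcategory)
  show "?M \<subseteq> heart" using W'_exact.targets_in_E W'_in_T T_heart by blast
  show "extension_closed D ?M" by (rule W'_exact.targets_extension_closed)
  show "abelian_category (full_sub D ?M)" by (rule W'_exact.targets_abelian)
  show "Hom_zero D X (ShO D i Y)" if "X \<in> ?M" "Y \<in> ?M" "i < 0" for X Y i
  proof -
    have "i = - int (Suc (nat (- i - 1)))" using that by simp
    then show ?thesis
      using negative_Hom_zero[OF W'_exact.targets_in_E[OF that(2)] W'_in_T[OF W'_exact.targets_in_E[OF that(1)]]] by metis
  qed
  show "short_exact (full_sub D ?M) X Y Z f g \<longleftrightarrow> (\<exists>h. triangle D X Y Z f g h)"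
    if "X \<in> ?M" "Y \<in> ?M" "Z \<in> ?M" for X Y Z f g
    using W'_exact.short_exact_if_triangle[OF _ that] W'_exact.triangle_if_short_exact by blast
qed

end

theorem proposition5p5:
  fixes D :: "('o, 'm) tricat"
    and L G T :: "'o set"
    and d :: nat
  assumes "triangulated_category D"
    and "bounded_t_structure D L G"
    and "d \<ge> 1"
    and "d_FAE_closed D L G d T"
  shows "wide_subcategory D L G d (W'' D T)"
proof -
  interpret triangulated_category D by (rule assms(1))
  interpret d_FAE_category D L G T d
    using assms by unfold_locales (simp_all add: bounded_t_structure_def)
  show ?thesis by (rule W''_wide)
qed

end
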